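(* If $g\in\mathcal{G}$ is a 1-pass tractable $\mathbb{S}$-normal function, then $g$ is slow-jumping, slow-dropping, and predictable.
   Context: Streams: a stream of length $m$ with domain $[n]$ is a list $D=\langle (i_1,\delta_1),\dots,(i_m,\delta_m)\rangle$ with $i_j\in[n]$, $\delta_j\in\mathbb{Z}$; its frequency vector $V(D)=v\in\mathbb{Z}^n$ has $v_i=\sum_{j:i_j=i}\delta_j$. (Turnstile model) there is $M\in\mathbb{N}$ such that the frequency vector of $D$ and of every prefix of $D$ lies in $\{-M,\dots,M\}^n$; throughout $M$ is polynomial in $n$. $\mathcal{D}(n,m)$ is the set of such streams with domain $[n]$ and length at most $m$. A $p$-pass algorithm reads the stream $p$ times in order and may use randomness. For $g:\mathbb{Z}_{\ge0}\to\mathbb{R}$ and $v\in\mathbb{Z}^n$ let $g(v)=\sum_{i=1}^n g(|v_i|)$. The problem $(g,\epsilon)$-SUM is to output $\hat G$ with $P\big((1-\epsilon)g(V(D))\le \hat G\le (1+\epsilon)g(V(D))\big)\ge 2/3$. A function $f:\mathbb{R}_{\ge0}\to\mathbb{R}_{\ge0}$ is sub-polynomial if for every $\alpha>0$, $\lim_{x\to\infty}x^\alpha f(x)=\infty$ and $\lim_{x\to\infty}x^{-\alpha}f(x)=0$. $g$ is $p$-pass tractable if for every sub-polynomial $h$ and every $\epsilon\ge 1/h(nM)$ there exist a sub-polynomial $h^*$ and a $p$-pass algorithm (with oracle access to $g$) that solves $(g,\epsilon)$-SUM for all streams in $\mathcal{D}(n,m)$ and all $n,M\ge1$ using at most $h^*(nM)$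 bits of space in the worst case. $\mathcal{G}=\{g:\mathbb{Z}_{\ge0}\to\mathbb{R}: g(0)=0,\ g(1)=1,\ g(x)>0\ \forall x>0\}$. $g$ is slow-jumping if for every $\alpha>0$ there is $N>0$ such that for all positive integers $x<y$ with $y\ge N$, $g(y)\le \lfloor y/x\rfloor^{2+\alpha}x^\alpha g(x)$. $g$ is slow-dropping if for every $\alpha>0$ there is $N>0$ such that for all $x<y$ with $y\ge N$, $g(y)\ge g(x)/y^\alpha$. For $x\in\mathbb{N}$, $\epsilon>0$ let $\delta_\epsilon(g,x)=\{y\in\mathbb{N}: |g(y)-g(x)|\le\epsilon g(x)\}$. $g$ is predictable if for every $0<\gamma<1$ and every sub-polynomial $\epsilon$ there is $N$ such that for all $x\ge N$ and all $y\in[1,x^{1-\gamma})$ with $x+y\notin\delta_{\epsilon(x)}(g,x)$ we have $g(y)\ge x^{-\gamma}g(x)$. For a set $\mathcal{S}$ of functions, $g$ is $\mathcal{S}$-nearly periodic if (1) there is $\alpha>0$ such that for every $N>0$ there exist $x,y\in\mathbb{N}$, $x<y$, $y\ge N$ with $g(y)\le g(x)/y^\alpha$ (such $y$ is called an $\alpha$-period of $g$); and (2) for every $\alpha>0$ and every $h\in\mathcal{S}$ there is $N_1>0$ such that for all $\alpha$-periods $y\ge N_1$ and all $x<y$ with $g(y)y^\alpha\le g(x)$, $|g(x+y)-g(x)|\le \min\{g(x),g(x+y)\}h(y)$. $g$ is $\mathcal{S}$-normal if it is not $\mathcal{S}$-nearly periodic. $\mathbb{S}$ denotes the set of non-increasing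 sub-polynomial functions on $\mathbb{Z}_{\ge0}$. *)

theory Defs
  imports "HOL-Probability.Probability"
begin

definition subpoly :: "(real \<Rightarrow> real) \<Rightarrow> bool" where
  "subpoly f \<longleftrightarrow> (\<forall>x\<ge>0. f x \<ge> 0) \<and>
     (\<forall>\<alpha>>0. filterlim (\<lambda>x. x powr \<alpha> * f x) at_top at_top \<and>
             ((\<lambda>x. x powr (-\<alpha>) * f x) \<longlongrightarrow> 0) at_top)"

definition subpoly_nat :: "(nat \<Rightarrow> real) \<Rightarrow> bool" where
  "subpoly_nat f \<longleftrightarrow> (\<forall>x. f x \<ge> 0) \<and>
     (\<forall>\<alpha>>0. filterlim (\<lambda>x. real x powr \<alpha> * f x) at_top sequentially \<and>
             ((\<lambda>x. real x powr (-\<alpha>) * f x) \<longlonglongrightarrow> 0))"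

definition SS :: "(nat \<Rightarrow> real) set" where
  "SS = {h. antimono h \<and> subpoly_nat h}"

type_synonym stream = "(nat \<times> int) list"

definition freq :: "stream \<Rightarrow> nat \<Rightarrow> int" where
  "freq D i = sum_list (map snd (filter (\<lambda>u. fst u = i) D))"

definition valid_stream :: "nat \<Rightarrow> nat \<Rightarrow> nat \<Rightarrow> stream \<Rightarrow> bool" where
  "valid_stream n M m D \<longleftrightarrow> length D \<le> m \<and> (\<forall>u\<in>set D. fst u \<in> {1..n}) \<and>
     (\<forall>k\<le>length D. \<forall>i. \<bar>freq (take k D) i\<bar> \<le> int M)"

definition gsum :: "(nat \<Rightarrow> real) \<Rightarrow> nat \<Rightarrow> (nat \<Rightarrow> int) \<Rightarrow> real" where
  "gsum g n v = (\<Sum>i=1..n. g (nat \<bar>v i\<bar>))"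

text \<open>A one-pass algorithm: a random seed (public randomness), an initial memory state,
  a transition function reading one stream update, and an output function.
  Memory states are natural numbers; using s bits means all states are below 2^s.\<close>
record alg =
  seed :: "nat pmf"
  init :: "nat \<Rightarrow> nat"
  step :: "nat \<Rightarrow> nat \<Rightarrow> nat \<times> int \<Rightarrow> nat"
  out  :: "nat \<Rightarrow> nat \<Rightarrow> real"

definition run :: "alg \<Rightarrow> nat \<Rightarrow> stream \<Rightarrow> real" where
  "run A \<omega> D = out A \<omega> (foldl (step A \<omega>) (init A \<omega>) D)"

definition uses_bits :: "alg \<Rightarrow> nat \<Rightarrow> bool" where
  "uses_bits A s \<longleftrightarrow> (\<forall>\<omega>. init A \<omega> < 2 ^ s) \<and>
     (\<forall>\<omega> q u. q < 2 ^ s \<longrightarrow> step A \<omega> q u < 2 ^ s)"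

definition solves_sum :: "(nat \<Rightarrow> real) \<Rightarrow> real \<Rightarrow> nat \<Rightarrow> nat \<Rightarrow> nat \<Rightarrow> alg \<Rightarrow> bool" where
  "solves_sum g eps n M m A \<longleftrightarrow> (\<forall>D. valid_stream n M m D \<longrightarrow>
     measure_pmf.prob (seed A)
       {\<omega>. (1 - eps) * gsum g n (freq D) \<le> run A \<omega> D \<and>
            run A \<omega> D \<le> (1 + eps) * gsum g n (freq D)} \<ge> 2/3)"

definition one_pass_tractable :: "(nat \<Rightarrow> real) \<Rightarrow> bool" where
  "one_pass_tractable g \<longleftrightarrow>
     (\<forall>h. subpoly h \<longrightarrow>
       (\<forall>eps :: nat \<Rightarrow> nat \<Rightarrow> real. (\<forall>n M. eps n M \<ge> 1 / h (real (n * M))) \<longrightarrow>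
         (\<exists>hs. subpoly hs \<and>
            (\<forall>n M m. n \<ge> 1 \<longrightarrow> M \<ge> 1 \<longrightarrow>
               (\<exists>A s. real s \<le> hs (real (n * M)) \<and> uses_bits A s \<and>
                      solves_sum g (eps n M) n M m A)))))"

definition GG :: "(nat \<Rightarrow> real) set" where
  "GG = {g. g 0 = 0 \<and> g 1 = 1 \<and> (\<forall>x>0. g x > 0)}"

definition slow_jumping :: "(nat \<Rightarrow> real) \<Rightarrow> bool" where
  "slow_jumping g \<longleftrightarrow> (\<forall>\<alpha>>0. \<exists>N>0. \<forall>x y::nat. 0 < x \<longrightarrow> x < y \<longrightarrow> N \<le> y \<longrightarrow>
      g y \<le> real (y div x) powr (2 + \<alpha>) * real x powr \<alpha> * g x)"

definition slow_dropping :: "(nat \<Rightarrow> real) \<Rightarrow> bool" where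
  "slow_dropping g \<longleftrightarrow> (\<forall>\<alpha>>0. \<exists>N>0. \<forall>x y::nat. x < y \<longrightarrow> N \<le> y \<longrightarrow>
      g y \<ge> g x / real y powr \<alpha>)"

definition delta_set :: "(nat \<Rightarrow> real) \<Rightarrow> real \<Rightarrow> nat \<Rightarrow> nat set" where
  "delta_set g eps x = {y. \<bar>g y - g x\<bar> \<le> eps * g x}"

definition predictable :: "(nat \<Rightarrow> real) \<Rightarrow> bool" where
  "predictable g \<longleftrightarrow> (\<forall>\<gamma>. 0 < \<gamma> \<and> \<gamma> < 1 \<longrightarrow> (\<forall>eps. subpoly eps \<longrightarrow>
     (\<exists>N. \<forall>x y::nat. N \<le> x \<longrightarrow> 1 \<le> y \<longrightarrow> real y < real x powr (1 - \<gamma>) \<longrightarrow>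
        x + y \<notin> delta_set g (eps (real x)) x \<longrightarrow> g y \<ge> real x powr (-\<gamma>) * g x)))"

definition nearly_periodic :: "(nat \<Rightarrow> real) set \<Rightarrow> (nat \<Rightarrow> real) \<Rightarrow> bool" where
  "nearly_periodic S g \<longleftrightarrow>
     (\<exists>\<alpha>>0. \<forall>N>0. \<exists>x y::nat. x < y \<and> N \<le> y \<and> g y \<le> g x / real y powr \<alpha>) \<and>
     (\<forall>\<alpha>>0. \<forall>h\<in>S. \<exists>N1>0. \<forall>y::nat. \<forall>x::nat.
        (\<exists>x'<y. g y \<le> g x' / real y powr \<alpha>) \<longrightarrow> N1 \<le> y \<longrightarrow> x < y \<longrightarrow>
        g y * real y powr \<alpha> \<le> g x \<longrightarrow>
        \<bar>g (x + y) - g x\<bar> \<le> min (g x) (g (x + y)) * h y)"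

definition normal :: "(nat \<Rightarrow> real) set \<Rightarrow> (nat \<Rightarrow> real) \<Rightarrow> bool" where
  "normal S g \<longleftrightarrow> \<not> nearly_periodic S g"

end

theory Submission
  imports Defs "HOL-Probability.Hoeffding" "HOL-Real_Asymp.Real_Asymp"
begin

text \<open>
  All three properties follow from one lower bound for a one-way, two-party game. Alice holds
  \<open>a = D + e\<close> with \<open>D\<close> in \<open>{0..<t}\<^sup>n\<close> and \<open>e\<close> in \<open>{0,1}\<^sup>n\<close>; Bob knows \<open>D\<close> and an index \<open>j\<close> and must
  decide whether \<open>a\<^sub>j\<close> is \<open>0\<close> or \<open>t\<close>. A message that allows this has to distinguish the values
  \<open>k\<close> and \<open>k + 1\<close> of an average coordinate with squared Hellinger distance of order \<open>1/t\<^sup>2\<close>, so it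
  needs \<open>\<Omega>(n/t\<^sup>2)\<close> bits. If Alice streams \<open>x a\<^sub>i\<close> and Bob streams \<open>- x D\<^sub>i\<close> for \<open>i \<noteq> j\<close> and \<open>r\<close> at
  \<open>j\<close>, the frequencies are \<open>0\<close> or \<open>x\<close> off \<open>j\<close>, and \<open>r\<close> or \<open>t x + r\<close> at \<open>j\<close>. Hence a small-space
  algorithm cannot exist when \<open>g x\<close> is tiny compared with a noticeable gap between \<open>g r\<close> and
  \<open>g (t x + r)\<close>. The case \<open>t = 1\<close> applies to functions that are not predictable and, by normality,
  to functions that are not slow-dropping. For slow-jumping, \<open>t\<close> and \<open>r\<close> are the quotient and
  remainder of \<open>y\<close> by \<open>x\<close>, and slow-dropping keeps \<open>g r\<close> far below \<open>g y\<close>.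
\<close>

section \<open>Bias of coordinates given a message\<close>

definition grid :: "nat \<Rightarrow> nat \<Rightarrow> (nat \<Rightarrow> nat) set" where
  "grid n k = PiE {..<n} (\<lambda>_. {..<k})"

lemma finite_grid [simp]: "finite (grid n k)"
  by (simp add: grid_def finite_PiE)

lemma card_grid [simp]: "card (grid n k) = k ^ n"
  by (simp add: grid_def card_PiE)

lemma grid_less: "f \<in> grid n k \<Longrightarrow> i < n \<Longrightarrow> f i < k"
  by (auto simp: grid_def PiE_def Pi_def)

text \<open>Overwriting coordinate \<open>j\<close> forgets its old value, so each grid point is hit
  \<open>k\<close> times. For \<open>k = 2\<close> this splits a sum by the value of
  \<open>e j\<close>; for \<open>k = t\<close> it lets \<open>D j\<close> range over all unit steps
  from 0 to \<open>t\<close>.\<close>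

lemma sum_grid_upd:
  fixes F :: "(nat \<Rightarrow> nat) \<Rightarrow> real"
  assumes "j < n"
  shows "(\<Sum>f\<in>grid n k. \<Sum>v<k. F (f(j := v))) = real k * (\<Sum>f\<in>grid n k. F f)"
proof -
  define R where "R = PiE ({..<n} - {j}) (\<lambda>_. {..<k})"
  have "grid n k = PiE (insert j ({..<n} - {j})) (\<lambda>_. {..<k})"
    using assms by (auto simp: grid_def insert_absorb)
  also have "\<dots> = (\<lambda>(v, f). f(j := v)) ` ({..<k} \<times> R)"
    unfolding R_def by (rule PiE_insert_eq)
  finally have grid: "grid n k = (\<lambda>(v, f). f(j := v)) ` ({..<k} \<times> R)" .
  have inj: "inj_on (\<lambda>(v, f). f(j := v)) ({..<k} \<times> R)"
    unfolding R_def by (rule inj_combinator[where T = "\<lambda>_. {..<k}"]) auto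
  have sum: "(\<Sum>f\<in>grid n k. G f) = (\<Sum>v<k. \<Sum>f\<in>R. G (f(j := v)))"
    for G :: "(nat \<Rightarrow> nat) \<Rightarrow> real"
    unfolding grid sum.reindex[OF inj]
    by (simp add: sum.cartesian_product case_prod_unfold)
  show ?thesis
    unfolding sum by (simp, subst sum.swap, simp)
qed

lemma sum_grid_prod:
  fixes F :: "nat \<Rightarrow> nat \<Rightarrow> real"
  shows "(\<Sum>f\<in>grid n k. \<Prod>i<n. F i (f i)) = (\<Prod>i<n. \<Sum>v<k. F i v)"
  unfolding grid_def by (subst prod_sum_PiE) auto

text \<open>This is Hoeffding's lemma for a fair sign, with probability 1/2 and width
  \<open>2 * y\<close>. The absolute value supplies a nonnegative argument, and \<open>cosh\<close>
  is even.\<close>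

lemma cosh_le_exp_half_square: "cosh (x::real) \<le> exp (x\<^sup>2 / 2)"
proof -
  define y where "y = \<bar>x\<bar>"
  have "- (2*y) * (1/2) + ln (1 + 1/2 * (exp (2*y) - 1)) \<le> (2*y)\<^sup>2 / 8"
    by (rule Hoeffdings_lemma_aux) (auto simp: y_def)
  then have "ln ((1 + exp (2*y)) / 2) \<le> y + y\<^sup>2 / 2"
    by (simp add: field_simps power2_eq_square)
  then have "(1 + exp (2*y)) / 2 \<le> exp (y + y\<^sup>2 / 2)"
    using add_pos_pos[OF zero_less_one exp_gt_zero[of "2*y"]]
    by (metis exp_le_cancel_iff exp_ln half_gt_zero)
  then have "exp (- y) * ((1 + exp (2*y)) / 2) \<le> exp (- y) * exp (y + y\<^sup>2 / 2)"
    by (intro mult_left_mono) auto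
  also have "\<dots> = exp (y\<^sup>2 / 2)"
    by (simp flip: exp_add)
  also have "exp (- y) * ((1 + exp (2*y)) / 2) = cosh y"
    by (simp add: cosh_field_def algebra_simps flip: exp_add)
  finally show ?thesis
    by (simp add: y_def)
qed

text \<open>The summed squared biases of the coordinates given the message bound the information in it
  from below. The proof takes the exponential moment of the coordinates weighted by their own
  biases, which plays the role of the chain rule for entropy.\<close>

lemma sum_square_bias_le:
  fixes q :: "(nat \<Rightarrow> nat) \<Rightarrow> nat" and n S :: nat
  assumes q: "\<And>e. q e < S"
  defines "P \<equiv> \<lambda>C. real (card {e \<in> grid n 2. q e = C})"
  defines "W \<equiv> \<lambda>j C. \<Sum>e\<in>{e \<in> grid n 2. q e = C}. 2 * real (e j) - 1"
  shows "(\<Sum>C<S. \<Sum>j<n. (W j C)\<^sup>2 / P C) \<le> 2 * 2 ^ n * ln S"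
proof -
  have S: "S > 0" using q[of undefined] by simp
  \<comment> \<open>The conditional mean of the sign \<open>2 * e j - 1\<close> given message
    \<open>C\<close>. For a message that never occurs, division by zero yields 0, which is the right
    contribution.\<close>
  define b where "b = (\<lambda>j C. W j C / P C)"
  \<comment> \<open>The subtracted square normalises the exponential tilt: averaged over the two
    values \<open>v\<close>, \<open>exp (z j C v)\<close> is at most 1.\<close>
  define z where "z = (\<lambda>j C v. b j C * (2 * real v - 1) - (b j C)\<^sup>2 / 2)"
  define Z where "Z = (\<lambda>e. \<Sum>j<n. z j (q e) (e j))"
  have two: "(\<Sum>v<2. f v) = f 0 + f 1" for f :: "nat \<Rightarrow> real"
    by (simp add: numeral_2_eq_2)
  have group: "(\<Sum>e\<in>grid n 2. f (q e) e) = (\<Sum>C<S. \<Sum>e\<in>{e \<in> grid n 2. q e = C}. f C e)"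
    for f :: "nat \<Rightarrow> (nat \<Rightarrow> nat) \<Rightarrow> real"
  proof -
    have "(\<Sum>e\<in>grid n 2. f (q e) e) = (\<Sum>C<S. \<Sum>e\<in>{e \<in> grid n 2. q e = C}. f (q e) e)"
      using q by (intro sum.group[symmetric]) auto
    then show ?thesis by simp
  qed
  have "(\<Sum>v<2. exp (z j C v)) \<le> 2" for j C
  proof -
    have "(\<Sum>v<2. exp (z j C v)) = 2 * cosh (b j C) * exp (- ((b j C)\<^sup>2 / 2))"
      by (simp add: two z_def cosh_field_def algebra_simps flip: exp_add)
    also have "\<dots> \<le> 2 * exp ((b j C)\<^sup>2 / 2) * exp (- ((b j C)\<^sup>2 / 2))"
      using cosh_le_exp_half_square by (intro mult_right_mono) auto
    finally show ?thesis by (simp add: mult.assoc flip: exp_add)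
  qed
  then have "(\<Prod>j<n. \<Sum>v<2. exp (z j C v)) \<le> 2 ^ n" for C
    using prod_mono[of "{..<n}" "\<lambda>j. \<Sum>v<2. exp (z j C v)" "\<lambda>_. 2"] by (simp add: sum_nonneg)
  then have cube: "(\<Sum>e\<in>grid n 2. exp (\<Sum>j<n. z j C (e j))) \<le> 2 ^ n" for C
    by (simp add: exp_sum sum_grid_prod[of "\<lambda>j v. exp (z j C v)"])
  \<comment> \<open>This is \<open>1 + s \<le> exp s\<close> at \<open>s = Z e - ln S\<close>. The
    shift turns the bound \<open>S * 2 ^ n\<close> on the sum of \<open>exp (Z e)\<close> into
    \<open>2 ^ n * ln S\<close> for the sum of \<open>Z e\<close>.\<close>
  have "(\<Sum>e\<in>grid n 2. real S * (1 + (Z e - ln S))) \<le> (\<Sum>e\<in>grid n 2. exp (Z e))"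
  proof (rule sum_mono)
    fix e
    have "real S * (1 + (Z e - ln S)) \<le> real S * exp (Z e - ln S)"
      by (intro mult_left_mono exp_ge_add_one_self) auto
    also have "\<dots> = exp (Z e)" using S by (simp add: exp_diff)
    finally show "real S * (1 + (Z e - ln S)) \<le> exp (Z e)" .
  qed
  also have "\<dots> = (\<Sum>C<S. \<Sum>e\<in>{e \<in> grid n 2. q e = C}. exp (\<Sum>j<n. z j C (e j)))"
    unfolding Z_def by (rule group)
  \<comment> \<open>Each fibre is enlarged to the whole cube, where the coordinates are independent;
    the resulting bound carries one factor \<open>S\<close>.\<close>
  also have "\<dots> \<le> (\<Sum>C<S. \<Sum>e\<in>grid n 2. exp (\<Sum>j<n. z j C (e j)))"
    by (intro sum_mono sum_mono2) auto
  also have "\<dots> \<le> (\<Sum>C<S. 2 ^ n)" by (intro sum_mono cube)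
  finally have "real S * (2 ^ n + ((\<Sum>e\<in>grid n 2. Z e) - 2 ^ n * ln S)) \<le> real S * 2 ^ n"
    by (simp add: sum.distrib sum_subtractf flip: sum_distrib_left)
  then have "(\<Sum>e\<in>grid n 2. Z e) \<le> 2 ^ n * ln S"
    using S by (simp only: mult_le_cancel_left_pos of_nat_0_less_iff)
  moreover have "(\<Sum>e\<in>grid n 2. Z e) = (\<Sum>C<S. \<Sum>j<n. (W j C)\<^sup>2 / P C) / 2"
  proof -
    have fiber: "(\<Sum>e\<in>{e \<in> grid n 2. q e = C}. z j C (e j)) = (W j C)\<^sup>2 / P C / 2" for j C
    proof -
      have "(\<Sum>e\<in>{e \<in> grid n 2. q e = C}. z j C (e j)) = b j C * W j C - P C * ((b j C)\<^sup>2 / 2)"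
        by (simp add: z_def W_def P_def sum_subtractf flip: sum_distrib_left)
      also have "\<dots> = (W j C)\<^sup>2 / P C / 2"
        by (cases "P C = 0") (auto simp: b_def field_simps power2_eq_square)
      finally show ?thesis .
    qed
    have "(\<Sum>e\<in>grid n 2. Z e) = (\<Sum>C<S. \<Sum>j<n. \<Sum>e\<in>{e \<in> grid n 2. q e = C}. z j C (e j))"
      unfolding Z_def by (subst group, subst sum.swap, rule refl)
    also have "\<dots> = (\<Sum>C<S. \<Sum>j<n. (W j C)\<^sup>2 / P C / 2)"
      by (simp only: fiber)
    finally show ?thesis by (simp add: sum_divide_distrib)
  qed
  ultimately show ?thesis by simp
qed

section \<open>The communication lower bound\<close>

text \<open>The difference \<open>p - q\<close> factors through the square roots, and
  \<open>(sqrt p + sqrt q)\<^sup>2\<close> is at least \<open>p + q\<close>. This bounds a squared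
  Hellinger term by a squared bias.\<close>

lemma sqrt_diff_square_le:
  assumes "p \<ge> 0" "q \<ge> 0"
  shows "(sqrt p - sqrt q)\<^sup>2 \<le> (p - q)\<^sup>2 / (p + q)"
proof (cases "p + q = 0")
  case True
  then have "p = 0" "q = 0" using assms by auto
  then show ?thesis by simp
next
  case False
  have "(sqrt p - sqrt q)\<^sup>2 * (p + q) \<le> (sqrt p - sqrt q)\<^sup>2 * (sqrt p + sqrt q)\<^sup>2"
    using assms by (intro mult_left_mono) (auto simp: power2_sum)
  also have "\<dots> = ((sqrt p)\<^sup>2 - (sqrt q)\<^sup>2)\<^sup>2"
    by (simp add: power2_eq_square algebra_simps)
  also have "\<dots> = (p - q)\<^sup>2"
    using assms by simp
  finally show ?thesis
    using False assms by (simp add: field_simps)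
qed

text \<open>Factor \<open>p - q\<close> and apply the weighted AM-GM inequality. The weights are
  such that the remainder \<open>(p + q) / 6\<close>, summed over messages, is half of the distance
  that success probability 2/3 forces.\<close>

lemma abs_diff_le_sqrt_diff:
  assumes "p \<ge> 0" "q \<ge> 0"
  shows "\<bar>p - q\<bar> \<le> 3 * (sqrt p - sqrt q)\<^sup>2 + (p + q) / 6"
proof -
  define u v where "u = \<bar>sqrt p - sqrt q\<bar>" and "v = sqrt p + sqrt q"
  have "p - q = (sqrt p - sqrt q) * v"
    using assms by (simp add: v_def algebra_simps)
  then have "\<bar>p - q\<bar> = u * v"
    using assms by (simp add: abs_mult u_def v_def)
  also have "u * v \<le> 3 * u\<^sup>2 + v\<^sup>2 / 12"
    using zero_le_power2[of "6 * u - v"] by (simp add: power2_eq_square algebra_simps)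
  also have "v\<^sup>2 \<le> 2 * (p + q)"
    using assms sum_squares_bound[of "sqrt p" "sqrt q"] by (simp add: v_def power2_sum)
  finally show ?thesis by (simp add: u_def add_divide_distrib)
qed

text \<open>Cauchy-Schwarz against the constant 1: a jump from 0 to \<open>t\<close> is charged to
  \<open>t\<close> unit steps at the price of a factor \<open>t\<close>.\<close>

lemma telescope_square_le:
  fixes f :: "nat \<Rightarrow> real"
  shows "(f t - f 0)\<^sup>2 \<le> real t * (\<Sum>k<t. (f (Suc k) - f k)\<^sup>2)"
proof -
  have "(\<Sum>k<t. (f (Suc k) - f k) * 1)\<^sup>2 \<le> (\<Sum>k<t. (f (Suc k) - f k)\<^sup>2) * (\<Sum>k<t. 1\<^sup>2)"
    by (rule Cauchy_Schwarz_ineq_sum)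
  then show ?thesis by (simp add: sum_lessThan_telescope mult.commute)
qed

text \<open>\<open>D + e\<close> with \<open>D\<close> in \<open>grid n t\<close> and \<open>e\<close> in \<open>grid n 2\<close> is the sender's input, of which the
  receiver knows \<open>D\<close>; \<open>q\<close> is the message, and \<open>w0\<close>, \<open>w1\<close> score the receiver's decision between
  the values \<open>0\<close> and \<open>t\<close> of coordinate \<open>j\<close>.\<close>

lemma gap_communication_lower_bound:
  fixes q :: "(nat \<Rightarrow> nat) \<Rightarrow> nat" and w0 w1 :: "nat \<Rightarrow> (nat \<Rightarrow> nat) \<Rightarrow> nat \<Rightarrow> real"
    and n t S :: nat
  assumes t: "t > 0" and q: "\<And>a. q a < S"
    and w: "\<And>j D C. w0 j D C \<ge> 0" "\<And>j D C. w1 j D C \<ge> 0"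
      "\<And>j D C. w0 j D C + w1 j D C \<le> 1"
    and success: "4/3 * (real n * real t ^ n * 2 ^ n) \<le>
      (\<Sum>j<n. \<Sum>D\<in>grid n t. \<Sum>e\<in>grid n 2.
         w0 j D (q ((\<lambda>i. D i + e i)(j := 0))) + w1 j D (q ((\<lambda>i. D i + e i)(j := t))))"
  shows "real n \<le> 36 * (real t)\<^sup>2 * ln (real S)"
proof -
  define K where "K = (2::real) ^ n"
  \<comment> \<open>Because \<open>j\<close> is overwritten, these counts depend on neither
    \<open>D j\<close> nor \<open>e j\<close>. Divided by \<open>K\<close> they are the distribution
    of the message given \<open>D\<close> and value \<open>k\<close> at \<open>j\<close>.\<close>
  define N where "N = (\<lambda>j D k C. real (card {e \<in> grid n 2. q ((\<lambda>i. D i + e i)(j := k)) = C}))"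
  define X where "X = (\<lambda>j D k. \<Sum>C<S. (sqrt (N j D (Suc k) C) - sqrt (N j D k C))\<^sup>2)"
  define Y where "Y = (\<lambda>j D. \<Sum>C<S. (sqrt (N j D t C) - sqrt (N j D 0 C))\<^sup>2)"
  have N0: "N j D k C \<ge> 0" for j D k C by (simp add: N_def)
  have two: "(\<Sum>v<2. f v) = f 0 + f 1" for f :: "nat \<Rightarrow> real"
    by (simp add: numeral_2_eq_2)
  have N_sum: "(\<Sum>e\<in>grid n 2. if q ((\<lambda>i. D i + e i)(j := k)) = C then 1 else 0) = N j D k C"
    for j D k C by (simp add: N_def sum.If_cases Int_def)
  have N_weight: "(\<Sum>e\<in>grid n 2. f (q ((\<lambda>i. D i + e i)(j := k)))) = (\<Sum>C<S. N j D k C * f C)"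
    for f :: "nat \<Rightarrow> real" and j D k
  proof -
    have "(\<Sum>e\<in>grid n 2. f (q ((\<lambda>i. D i + e i)(j := k)))) =
      (\<Sum>C<S. \<Sum>e\<in>{e \<in> grid n 2. q ((\<lambda>i. D i + e i)(j := k)) = C}. f (q ((\<lambda>i. D i + e i)(j := k))))"
      using q by (intro sum.group[symmetric]) auto
    also have "\<dots> = (\<Sum>C<S. N j D k C * f C)"
      by (intro sum.cong refl) (simp add: N_def)
    finally show ?thesis .
  qed
  have N_total: "(\<Sum>C<S. N j D k C) = K" for j D k
    using N_weight[of "\<lambda>_. 1" D j k] by (simp add: K_def)
  \<comment> \<open>For fixed \<open>D\<close>, the bit \<open>e j\<close> chooses between the
    values \<open>D j\<close> and \<open>Suc (D j)\<close>. So the bias bound controls, summed over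
    \<open>j\<close>, just the unit step that starts at \<open>D j\<close>.\<close>
  have info: "(\<Sum>j<n. X j D (D j)) \<le> 4 * K * ln S" for D
  proof -
    define q' where "q' = (\<lambda>e. q (\<lambda>i. D i + e i))"
    define P where "P = (\<lambda>C. real (card {e \<in> grid n 2. q' e = C}))"
    define W where "W = (\<lambda>j C. \<Sum>e\<in>{e \<in> grid n 2. q' e = C}. 2 * real (e j) - 1)"
    have le: "(\<Sum>C<S. \<Sum>j<n. (W j C)\<^sup>2 / P C) \<le> 2 * 2 ^ n * ln S"
      unfolding W_def P_def by (rule sum_square_bias_le) (simp add: q'_def q)
    have upd: "q' (e(j := v)) = q ((\<lambda>i. D i + e i)(j := D j + v))" for e j v
      unfolding q'_def by (rule arg_cong[where f = q]) auto
    have step: "(sqrt (N j D (Suc (D j)) C) - sqrt (N j D (D j) C))\<^sup>2 \<le> 2 * ((W j C)\<^sup>2 / P C)"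
      if j: "j < n" for j C
    proof -
      have "2 * P C = real 2 * (\<Sum>e\<in>grid n 2. if q' e = C then 1 else 0)"
        by (simp add: P_def sum.If_cases Int_def)
      also have "\<dots> = (\<Sum>e\<in>grid n 2. \<Sum>v<2. if q' (e(j := v)) = C then 1 else 0)"
        by (rule sum_grid_upd[OF j, symmetric])
      also have "\<dots> = N j D (D j) C + N j D (Suc (D j)) C"
        unfolding two sum.distrib upd N_sum by simp
      finally have P: "P C = (N j D (Suc (D j)) C + N j D (D j) C) / 2" by simp
      have "2 * W j C = real 2 * (\<Sum>e\<in>grid n 2. if q' e = C then 2 * real (e j) - 1 else 0)"
        by (simp add: W_def sum.If_cases Int_def)
      also have "\<dots> = (\<Sum>e\<in>grid n 2. \<Sum>v<2. if q' (e(j := v)) = C then 2 * real ((e(j := v)) j) - 1 else 0)"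
        by (rule sum_grid_upd[OF j, symmetric])
      also have "\<dots> = (\<Sum>e\<in>grid n 2. (if q' (e(j := 1)) = C then 1 else 0) - (if q' (e(j := 0)) = C then 1 else 0))"
        unfolding two by (intro sum.cong refl) simp
      also have "\<dots> = N j D (Suc (D j)) C - N j D (D j) C"
        unfolding sum_subtractf upd N_sum by simp
      finally have W: "W j C = (N j D (Suc (D j)) C - N j D (D j) C) / 2" by simp
      have half: "2 * ((x / 2)\<^sup>2 / (y / 2)) = x\<^sup>2 / y" for x y :: real
        by (simp add: power2_eq_square)
      show ?thesis
        unfolding P W half by (rule sqrt_diff_square_le[OF N0 N0])
    qed
    have "(\<Sum>j<n. X j D (D j)) \<le> (\<Sum>j<n. \<Sum>C<S. 2 * ((W j C)\<^sup>2 / P C))"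
      unfolding X_def by (intro sum_mono step) simp
    also have "\<dots> = 2 * (\<Sum>C<S. \<Sum>j<n. (W j C)\<^sup>2 / P C)"
      by (subst sum.swap) (simp add: sum_distrib_left)
    also have "\<dots> \<le> 4 * K * ln S" using le by (simp add: K_def mult_ac)
    finally show ?thesis .
  qed
  \<comment> \<open>Only one of the \<open>t\<close> steps is controlled for each \<open>D\<close>,
    but averaging over \<open>D\<close> makes \<open>D j\<close> uniform. One factor
    \<open>t\<close> comes from this averaging, the other from telescoping.\<close>
  have path: "(\<Sum>D\<in>grid n t. Y j D) \<le> (real t)\<^sup>2 * (\<Sum>D\<in>grid n t. X j D (D j))" if j: "j < n" for j
  proof -
    have N_upd: "N j (D(j := k)) = N j D" for D k
    proof -
      have "(\<lambda>i. (D(j := k)) i + e i)(j := v) = (\<lambda>i. D i + e i)(j := v)" for e v by auto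
      then show ?thesis by (simp add: N_def)
    qed
    have Y: "Y j D \<le> real t * (\<Sum>k<t. X j D k)" for D
    proof -
      have "Y j D \<le> (\<Sum>C<S. real t * (\<Sum>k<t. (sqrt (N j D (Suc k) C) - sqrt (N j D k C))\<^sup>2))"
        unfolding Y_def by (intro sum_mono telescope_square_le)
      also have "\<dots> = real t * (\<Sum>k<t. X j D k)"
        unfolding X_def by (subst sum.swap) (simp add: sum_distrib_left)
      finally show ?thesis .
    qed
    have "(\<Sum>D\<in>grid n t. Y j D) \<le> real t * (\<Sum>D\<in>grid n t. \<Sum>k<t. X j D k)"
      by (subst sum_distrib_left) (intro sum_mono Y)
    also have "(\<Sum>D\<in>grid n t. \<Sum>k<t. X j D k) = (\<Sum>D\<in>grid n t. \<Sum>k<t. X j (D(j := k)) ((D(j := k)) j))"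
      by (simp add: X_def N_upd)
    also have "\<dots> = real t * (\<Sum>D\<in>grid n t. X j D (D j))"
      by (rule sum_grid_upd[OF j])
    finally show ?thesis by (simp add: power2_eq_square)
  qed
  have "(\<Sum>e\<in>grid n 2. w0 j D (q ((\<lambda>i. D i + e i)(j := 0))) + w1 j D (q ((\<lambda>i. D i + e i)(j := t))))
    \<le> 7/6 * K + 3/2 * Y j D" for j D
  proof -
    \<comment> \<open>No decision beats the maximum of the two counts, which is
      \<open>(u + v + \<bar>v - u\<bar>) / 2\<close>. The constant 7/12 is 1/2 plus half of
      1/6.\<close>
    have "N j D 0 C * w0 j D C + N j D t C * w1 j D C
        \<le> 7/12 * (N j D 0 C + N j D t C) + 3/2 * (sqrt (N j D t C) - sqrt (N j D 0 C))\<^sup>2" for C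
    proof -
      define u v where "u = N j D 0 C" and "v = N j D t C"
      have "u \<le> (u + v + \<bar>v - u\<bar>) / 2" "v \<le> (u + v + \<bar>v - u\<bar>) / 2" by auto
      then have "u * w0 j D C + v * w1 j D C \<le>
          (u + v + \<bar>v - u\<bar>) / 2 * w0 j D C + (u + v + \<bar>v - u\<bar>) / 2 * w1 j D C"
        using w by (intro add_mono mult_right_mono)
      also have "\<dots> = (u + v + \<bar>v - u\<bar>) / 2 * (w0 j D C + w1 j D C)"
        by (rule distrib_left[symmetric])
      also have "\<dots> \<le> (u + v + \<bar>v - u\<bar>) / 2 * 1"
        using w(3) by (intro mult_left_mono) (auto simp: u_def v_def N0)
      finally have "u * w0 j D C + v * w1 j D C \<le> (u + v + \<bar>v - u\<bar>) / 2" by simp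
      moreover have "\<bar>v - u\<bar> \<le> 3 * (sqrt v - sqrt u)\<^sup>2 + (v + u) / 6"
        by (rule abs_diff_le_sqrt_diff) (auto simp: u_def v_def N0)
      moreover have "A \<le> (u + v + B) / 2 \<Longrightarrow> B \<le> 3 * d + (v + u) / 6 \<Longrightarrow> A \<le> 7/12 * (u + v) + 3/2 * d"
        for A B d :: real by (simp add: field_simps)
      ultimately show ?thesis
        unfolding u_def v_def by blast
    qed
    then have "(\<Sum>C<S. N j D 0 C * w0 j D C + N j D t C * w1 j D C)
        \<le> (\<Sum>C<S. 7/12 * (N j D 0 C + N j D t C) + 3/2 * (sqrt (N j D t C) - sqrt (N j D 0 C))\<^sup>2)"
      by (intro sum_mono)
    also have "\<dots> = 7/12 * ((\<Sum>C<S. N j D 0 C) + (\<Sum>C<S. N j D t C)) + 3/2 * Y j D"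
      by (simp only: sum.distrib Y_def sum_distrib_left [symmetric])
    also have "\<dots> = 7/6 * K + 3/2 * Y j D"
      by (simp add: N_total)
    finally show ?thesis
      unfolding sum.distrib N_weight .
  qed
  then have "4/3 * (real n * real t ^ n * 2 ^ n) \<le> (\<Sum>j<n. \<Sum>D\<in>grid n t. 7/6 * K + 3/2 * Y j D)"
    by (intro order_trans[OF success] sum_mono)
  also have "\<dots> = 7/6 * (real n * real t ^ n * K) + 3/2 * (\<Sum>j<n. \<Sum>D\<in>grid n t. Y j D)"
    by (simp only: sum.distrib sum_distrib_left [symmetric]) simp
  \<comment> \<open>The surplus 4/3 - 7/6 = 1/6 against the coefficient 3/2 gives 9; the 4 in
    \<open>info\<close> later makes it 36.\<close>
  finally have "real n * real t ^ n * K \<le> 9 * (\<Sum>j<n. \<Sum>D\<in>grid n t. Y j D)"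
    by (simp add: K_def)
  also have "(\<Sum>j<n. \<Sum>D\<in>grid n t. Y j D) \<le> (\<Sum>j<n. (real t)\<^sup>2 * (\<Sum>D\<in>grid n t. X j D (D j)))"
    by (intro sum_mono path) simp
  also have "\<dots> = (real t)\<^sup>2 * (\<Sum>D\<in>grid n t. \<Sum>j<n. X j D (D j))"
    by (subst sum.swap) (simp add: sum_distrib_left)
  also have "\<dots> \<le> (real t)\<^sup>2 * (\<Sum>D\<in>grid n t. 4 * K * ln S)"
    by (intro mult_left_mono sum_mono info) auto
  finally have "(real t ^ n * K) * real n \<le> (real t ^ n * K) * (36 * (real t)\<^sup>2 * ln S)"
    by (simp add: algebra_simps)
  then show ?thesis
    using t by (subst (asm) mult_le_cancel_left_pos) (auto simp: K_def)
qed

section \<open>From streams to communication\<close>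

lemma freq_append [simp]: "freq (xs @ ys) i = freq xs i + freq ys i"
  by (simp add: freq_def)

lemma freq_map_upt:
  "freq (map (\<lambda>i. (Suc i, d i)) [0..<n]) k = (if 1 \<le> k \<and> k \<le> n then d (k - 1) else 0)"
  by (induction n) (auto simp: freq_def)

lemma take_upt_min: "take k [0..<n] = [0..<min k n]"
  by (cases "k \<le> n") auto

text \<open>The shift by \<open>Suc\<close> is needed because streams live on \<open>{1..n}\<close>,
  while inputs are indexed by \<open>{..<n}\<close>.\<close>

definition alice :: "nat \<Rightarrow> nat \<Rightarrow> (nat \<Rightarrow> nat) \<Rightarrow> stream" where
  "alice n x a = map (\<lambda>i. (Suc i, int (x * a i))) [0..<n]"

definition bob :: "nat \<Rightarrow> nat \<Rightarrow> nat \<Rightarrow> nat \<Rightarrow> (nat \<Rightarrow> nat) \<Rightarrow> stream" where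
  "bob n x r j D = map (\<lambda>i. (Suc i, if i = j then int r else - int (x * D i))) [0..<n]"

text \<open>Each party updates each coordinate once, so a prefix shows a coordinate as 0, after
  Alice, or after Bob. Overwriting may put \<open>a j\<close> below \<open>D j\<close>, which is
  harmless since Bob subtracts nothing at \<open>j\<close>.\<close>

lemma valid_alice_bob:
  assumes M: "\<And>i. i < n \<Longrightarrow> x * a i \<le> M" "x * a j + r \<le> M"
    and le: "\<And>i. i < n \<Longrightarrow> i \<noteq> j \<Longrightarrow> D i \<le> a i"
  shows "valid_stream n M (2 * n) (alice n x a @ bob n x r j D)"
  unfolding valid_stream_def
proof (intro conjI ballI allI impI)
  fix k i
  show "\<bar>freq (take k (alice n x a @ bob n x r j D)) i\<bar> \<le> int M"
  proof (cases "1 \<le> i \<and> i \<le> n")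
    case True
    have "i - 1 < n" using True by auto
    then have "int (x * a (i - 1)) \<le> int M"
      using M(1) by (simp only: of_nat_le_iff)
    moreover have "0 \<le> int (x * a (i - 1))" by simp
    moreover have "int (x * a j + r) \<le> int M"
      using M(2) by (simp only: of_nat_le_iff)
    moreover have "i - 1 \<noteq> j \<Longrightarrow> int (x * D (i - 1)) \<le> int (x * a (i - 1))"
      using le[of "i - 1"] \<open>i - 1 < n\<close> by (intro of_nat_mono mult_le_mono2) auto
    ultimately show ?thesis
      using True
      by (auto simp: alice_def bob_def take_map take_upt_min freq_map_upt simp del: of_nat_mult)
  next
    case False
    then show ?thesis
      by (auto simp: alice_def bob_def take_map take_upt_min freq_map_upt)
  qed
qed (auto simp: alice_def bob_def)

lemma gsum_alice_bob:
  fixes n x r j v :: nat and D e :: "nat \<Rightarrow> nat"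
  assumes g: "g 0 = 0" "\<And>x. g x \<ge> 0" and e: "\<And>i. i < n \<Longrightarrow> e i < 2" and j: "j < n"
  defines "G \<equiv> gsum g n (freq (alice n x ((\<lambda>i. D i + e i)(j := v)) @ bob n x r j D))"
  shows "g (x * v + r) \<le> G" "G \<le> g (x * v + r) + real n * g x"
proof -
  have "nat \<bar>freq (alice n x ((\<lambda>i. D i + e i)(j := v)) @ bob n x r j D) (Suc i)\<bar> =
      (if i = j then x * v + r else x * e i)" if "i < n" for i
  proof -
    have "nat (int (x * v) + int r) = x * v + r"
      by (metis nat_int of_nat_add)
    moreover have "int (x * (D i + e i)) - int (x * D i) = int (x * e i)"
      by (simp add: algebra_simps)
    ultimately show ?thesis
      using that by (simp add: alice_def bob_def freq_map_upt del: of_nat_mult of_nat_add)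
  qed
  then have "G = (\<Sum>i<n. g (if i = j then x * v + r else x * e i))"
    unfolding G_def gsum_def One_nat_def sum.atLeast1_atMost_eq by (intro sum.cong) auto
  also have "\<dots> = g (x * v + r) + (\<Sum>i\<in>{..<n} - {j}. g (x * e i))"
    using j by (subst sum.remove[of _ j]) (auto intro!: sum.cong)
  finally have G: "G = g (x * v + r) + (\<Sum>i\<in>{..<n} - {j}. g (x * e i))" .
  then show "g (x * v + r) \<le> G"
    using g by (simp add: sum_nonneg)
  have "(\<Sum>i\<in>{..<n} - {j}. g (x * e i)) \<le> (\<Sum>i\<in>{..<n} - {j}. g x)"
  proof (rule sum_mono)
    fix i assume "i \<in> {..<n} - {j}"
    then have "e i = 0 \<or> e i = 1" using e[of i] by auto
    then show "g (x * e i) \<le> g x" using g by auto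
  qed
  also have "\<dots> \<le> (\<Sum>i<n. g x)"
    using g by (intro sum_mono2) auto
  finally show "G \<le> g (x * v + r) + real n * g x"
    by (simp add: G)
qed

text \<open>The expected number of events that occur is at least \<open>c * real (card I)\<close>,
  so some outcome attains this. It serves to fix the random seed.\<close>

lemma exists_many_events:
  fixes p :: "'a pmf"
  assumes I: "finite I" and c: "\<And>i. i \<in> I \<Longrightarrow> c \<le> measure_pmf.prob p (E i)"
  shows "\<exists>\<omega>. c * real (card I) \<le> (\<Sum>i\<in>I. indicator (E i) \<omega>)"
proof (rule ccontr)
  assume "\<not> ?thesis"
  then have less: "(\<Sum>i\<in>I. indicator (E i) \<omega>) < c * real (card I)" for \<omega>
    by (auto simp: not_le)
  have int: "integrable (measure_pmf p) (indicat_real (E i))" for i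
    by (rule measure_pmf.integrable_const_bound[where B = 1]) auto
  have "measure_pmf.expectation p (\<lambda>\<omega>. \<Sum>i\<in>I. indicat_real (E i) \<omega>) < c * real (card I)"
    using less by (intro measure_pmf.expectation_less)
      (auto intro!: Bochner_Integration.integrable_sum int)
  also have "measure_pmf.expectation p (\<lambda>\<omega>. \<Sum>i\<in>I. indicat_real (E i) \<omega>) =
      (\<Sum>i\<in>I. measure_pmf.prob p (E i))"
    by (subst Bochner_Integration.integral_sum) (auto intro!: int)
  also have "(\<Sum>i\<in>I. measure_pmf.prob p (E i)) \<ge> c * real (card I)"
    using sum_mono[OF c, of I "\<lambda>i. i"] by (simp add: mult.commute)
  finally show False by simp
qed

lemma foldl_step_less:
  assumes "uses_bits A s" "q < 2 ^ s"
  shows "foldl (step A \<omega>) q D < 2 ^ s"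
  using assms(2) by (induction D arbitrary: q) (use assms(1) in \<open>auto simp: uses_bits_def\<close>)

text \<open>The message is the memory state after Alice's stream, for one seed that is right on
  average over all games. By \<open>sep\<close>, the outputs permitted for the values 0 and
  \<open>t\<close> are disjoint even with the noise \<open>real n * g x\<close>, so Bob can
  decide.\<close>

lemma sum_space_lower_bound:
  assumes g: "g 0 = 0" "\<And>x. g x \<ge> 0" and A: "uses_bits A s" "solves_sum g eps n M (2 * n) A"
    and t: "t > 0" and M: "x * t + r \<le> M" and eps: "0 \<le> eps" "eps \<le> 1"
    and sep: "(1 + eps) * (g r + real n * g x) < (1 - eps) * g (x * t + r) \<or>
      (1 + eps) * (g (x * t + r) + real n * g x) < (1 - eps) * g r"
  shows "real n \<le> 36 * (real t)\<^sup>2 * real s"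
proof -
  define a where "a = (\<lambda>(j::nat) D e v. (\<lambda>i. D i + e i :: nat)(j := v))"
  define E where "E = (\<lambda>(j, D, e, v). {\<omega>.
    (1 - eps) * gsum g n (freq (alice n x (a j D e v) @ bob n x r j D))
      \<le> run A \<omega> (alice n x (a j D e v) @ bob n x r j D) \<and>
    run A \<omega> (alice n x (a j D e v) @ bob n x r j D)
      \<le> (1 + eps) * gsum g n (freq (alice n x (a j D e v) @ bob n x r j D))})"
  define I where "I = {..<n} \<times> grid n t \<times> grid n 2 \<times> {0, t}"
  have "2/3 \<le> measure_pmf.prob (seed A) (E i)" if "i \<in> I" for i
  proof -
    obtain j D e v where i: "i = (j, D, e, v)" by (cases i)
    have ivs: "j < n" "D \<in> grid n t" "e \<in> grid n 2" "v = 0 \<or> v = t"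
      using that by (auto simp: I_def i)
    have "valid_stream n M (2 * n) (alice n x (a j D e v) @ bob n x r j D)"
    proof (rule valid_alice_bob)
      fix k assume "k < n"
      have "a j D e v k \<le> t"
        using ivs \<open>k < n\<close> grid_less[of D n t k] grid_less[of e n 2 k] by (auto simp: a_def)
      then have "x * a j D e v k \<le> x * t" by (rule mult_le_mono2)
      then show "x * a j D e v k \<le> M" using M by linarith
    qed (use M ivs in \<open>auto simp: a_def\<close>)
    then show ?thesis
      using A(2) by (simp add: solves_sum_def E_def i)
  qed
  then obtain \<omega> where \<omega>: "2/3 * real (card I) \<le> (\<Sum>i\<in>I. indicator (E i) \<omega>)"
    using exists_many_events[of I "2/3" "seed A" E] by (auto simp: I_def)
  define q where "q = (\<lambda>a. foldl (step A \<omega>) (init A \<omega>) (alice n x a))"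
  define R where "R = (\<lambda>v. {z. (1 - eps) * g (x * v + r) \<le> z \<and>
    z \<le> (1 + eps) * (g (x * v + r) + real n * g x)})"
  define w where "w = (\<lambda>v j D C. indicat_real (R v) (out A \<omega> (foldl (step A \<omega>) C (bob n x r j D))))"
  have "real n \<le> 36 * (real t)\<^sup>2 * ln (real (2 ^ s))"
  proof (rule gap_communication_lower_bound[where q = q and ?w0.0 = "w 0" and ?w1.0 = "w t"])
    show "q a < 2 ^ s" for a
      unfolding q_def using A(1) by (intro foldl_step_less) (auto simp: uses_bits_def)
    have "R 0 \<inter> R t = {}" using sep by (auto simp: R_def)
    then show "w 0 j D C + w t j D C \<le> 1" for j D C
      by (auto simp: w_def indicator_def)
    have le: "indicat_real (E (j, D, e, v)) \<omega> \<le> w v j D (q ((\<lambda>i. D i + e i)(j := v)))"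
      if j: "j < n" and e: "e \<in> grid n 2" for j D e v
    proof (cases "\<omega> \<in> E (j, D, e, v)")
      case True
      define G where "G = gsum g n (freq (alice n x (a j D e v) @ bob n x r j D))"
      have G: "g (x * v + r) \<le> G" "G \<le> g (x * v + r) + real n * g x"
        unfolding G_def a_def
        by (rule gsum_alice_bob[where g = g and e = e]; use g e j grid_less in auto)+
      have "(1 - eps) * g (x * v + r) \<le> (1 - eps) * G"
        "(1 + eps) * G \<le> (1 + eps) * (g (x * v + r) + real n * g x)"
        using eps G by (auto intro: mult_left_mono)
      moreover have "(1 - eps) * G \<le> run A \<omega> (alice n x (a j D e v) @ bob n x r j D)"
        "run A \<omega> (alice n x (a j D e v) @ bob n x r j D) \<le> (1 + eps) * G"
        using True by (simp_all add: E_def G_def)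
      ultimately have "run A \<omega> (alice n x (a j D e v) @ bob n x r j D) \<in> R v"
        by (simp add: R_def)
      then show ?thesis
        by (simp add: w_def q_def run_def a_def)
    qed (simp add: w_def)
    have card: "4/3 * (real n * real t ^ n * 2 ^ n) = 2/3 * real (card I)"
      using t by (simp add: I_def card_cartesian_product)
    have split: "(\<Sum>i\<in>I. f i) = (\<Sum>j<n. \<Sum>D\<in>grid n t. \<Sum>e\<in>grid n 2. f (j, D, e, 0) + f (j, D, e, t))"
      for f :: "_ \<Rightarrow> real"
      using t unfolding I_def by (simp add: sum.cartesian_product')
    have "(\<Sum>i\<in>I. indicator (E i) \<omega>) = (\<Sum>j<n. \<Sum>D\<in>grid n t. \<Sum>e\<in>grid n 2.
        indicat_real (E (j, D, e, 0)) \<omega> + indicat_real (E (j, D, e, t)) \<omega>)"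
      by (rule split[of "\<lambda>i. indicator (E i) \<omega>"])
    also have "\<dots> \<le> (\<Sum>j<n. \<Sum>D\<in>grid n t. \<Sum>e\<in>grid n 2.
         w 0 j D (q ((\<lambda>i. D i + e i)(j := 0))) + w t j D (q ((\<lambda>i. D i + e i)(j := t))))"
      by (intro sum_mono add_mono le) auto
    finally show "4/3 * (real n * real t ^ n * 2 ^ n) \<le> (\<Sum>j<n. \<Sum>D\<in>grid n t. \<Sum>e\<in>grid n 2.
         w 0 j D (q ((\<lambda>i. D i + e i)(j := 0))) + w t j D (q ((\<lambda>i. D i + e i)(j := t))))"
      unfolding card by (rule order_trans[OF \<omega>])
  qed (use t in \<open>auto simp: w_def\<close>)
  also have "ln (real (2 ^ s)) \<le> real s"
    using ln_le_minus_one[of 2] by (simp add: ln_realpow mult_left_le)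
  finally show ?thesis by (simp add: mult_left_mono)
qed

section \<open>Sub-polynomial functions\<close>

lemma nat_powr_at_top: "a > 0 \<Longrightarrow> filterlim (\<lambda>k. real k powr a) at_top sequentially"
  by real_asymp

text \<open>Boundedness by 1 settles the upper growth condition. For the lower one, comparing with
  exponent \<open>\<alpha> / 2\<close> leaves a divergent factor.\<close>

lemma SS_I:
  assumes "antimono h" "\<And>k. 0 \<le> h k" "\<And>k. h k \<le> 1"
    and ge: "\<And>\<alpha>. \<alpha> > 0 \<Longrightarrow> eventually (\<lambda>k. real k powr (- \<alpha>) \<le> h k) sequentially"
  shows "h \<in> SS"
proof -
  have "filterlim (\<lambda>k. real k powr \<alpha> * h k) at_top sequentially" if "\<alpha> > 0" for \<alpha>
  proof (rule filterlim_at_top_mono[OF nat_powr_at_top[of "\<alpha> / 2"]])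
    show "eventually (\<lambda>k. real k powr (\<alpha> / 2) \<le> real k powr \<alpha> * h k) sequentially"
      using ge[OF half_gt_zero[OF that]]
    proof eventually_elim
      case (elim k)
      have "real k powr (\<alpha> / 2) = real k powr \<alpha> * real k powr (- (\<alpha> / 2))"
        by (simp flip: powr_add)
      also have "\<dots> \<le> real k powr \<alpha> * h k"
        using elim by (intro mult_left_mono) auto
      finally show ?case .
    qed
  qed (use that in simp)
  moreover have "(\<lambda>k. real k powr (- \<alpha>) * h k) \<longlonglongrightarrow> 0" if "\<alpha> > 0" for \<alpha>
  proof (rule tendsto_sandwich[OF _ _ tendsto_const])
    show "(\<lambda>k. real k powr (- \<alpha>)) \<longlonglongrightarrow> 0"
      using that by real_asymp
    show "eventually (\<lambda>k. real k powr (- \<alpha>) * h k \<le> real k powr (- \<alpha>)) sequentially"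
      using assms(2,3) by (simp add: mult_left_le)
  qed (use assms(2) in simp)
  ultimately show ?thesis
    using assms(1,2) by (simp add: SS_def subpoly_nat_def)
qed

lemma SS_at_top:
  "h \<in> SS \<Longrightarrow> \<alpha> > 0 \<Longrightarrow> filterlim (\<lambda>k. real k powr \<alpha> * h k) at_top sequentially"
  by (simp add: SS_def subpoly_nat_def)

lemma SS_ge_powr:
  assumes "h \<in> SS" "\<alpha> > 0" and c: "c > 0"
  shows "eventually (\<lambda>k. real k powr (- \<alpha>) \<le> c * h k) sequentially"
proof -
  have "eventually (\<lambda>k. 1 / c \<le> real k powr \<alpha> * h k) sequentially"
    using SS_at_top[OF assms(1,2)] by (simp add: filterlim_at_top)
  then show ?thesis
    using eventually_gt_at_top[of 0]
  proof eventually_elim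
    case (elim k)
    have "real k powr (- \<alpha>) = c * (1 / c * real k powr (- \<alpha>))"
      using c by simp
    also have "\<dots> \<le> c * (real k powr \<alpha> * h k * real k powr (- \<alpha>))"
      using elim c by (intro mult_left_mono mult_right_mono) auto
    also have "\<dots> = c * h k"
      using elim by (simp add: powr_minus field_simps)
    finally show ?case .
  qed
qed

lemma SS_antimono: "h \<in> SS \<Longrightarrow> i \<le> j \<Longrightarrow> h j \<le> h i"
  by (auto simp: SS_def dest: antimonoD)

text \<open>A non-increasing function that is positive arbitrarily far out is positive
  everywhere.\<close>

lemma SS_pos:
  assumes "h \<in> SS"
  shows "h k > 0"
proof -
  have "eventually (\<lambda>j. real j powr (- 1) \<le> 1 * h j) sequentially"
    by (rule SS_ge_powr[OF assms]) auto
  then have "eventually (\<lambda>j. k \<le> j \<and> 0 < j \<and> real j powr (- 1) \<le> 1 * h j) sequentially"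
    by (intro eventually_conj eventually_ge_at_top eventually_gt_at_top)
  then obtain j where "k \<le> j" "0 < j" "real j powr (- 1) \<le> h j"
    by (auto simp: eventually_sequentially)
  moreover have "0 < real j powr (- 1)" using \<open>0 < j\<close> by simp
  ultimately show ?thesis
    using SS_antimono[OF assms, of k j] by linarith
qed

lemma SS_min_one:
  assumes "h \<in> SS"
  shows "(\<lambda>k. min 1 (h k)) \<in> SS"
proof (rule SS_I)
  show "antimono (\<lambda>k. min 1 (h k))"
    using SS_antimono[OF assms] by (intro antimonoI min.mono) auto
  show "0 \<le> min 1 (h k)" for k
    using SS_pos[OF assms, of k] by simp
  show "eventually (\<lambda>k. real k powr (- \<alpha>) \<le> min 1 (h k)) sequentially" if "\<alpha> > 0" for \<alpha>
    using SS_ge_powr[OF assms that zero_less_one] eventually_ge_at_top[of 1]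
    by eventually_elim (use that in \<open>auto simp: powr_minus field_simps ge_one_powr_ge_zero\<close>)
qed auto

text \<open>The minorant is the running minimum of \<open>f\<close>, started at an index from which
  \<open>f\<close> is positive and capped at 1. It supplies the monotonicity that an arbitrary
  accuracy function lacks.\<close>

lemma SS_below_subpoly:
  assumes "subpoly f"
  obtains h where "h \<in> SS" "\<And>k. h k \<le> 1" "eventually (\<lambda>k. h k \<le> f (real k)) sequentially"
proof -
  have ge: "eventually (\<lambda>k. real k powr (- \<alpha>) \<le> f (real k)) sequentially" if "\<alpha> > 0" for \<alpha>
  proof -
    have "eventually (\<lambda>x. 1 \<le> x powr \<alpha> * f x) at_top"
      using assms that by (simp add: subpoly_def filterlim_at_top)
    then have "eventually (\<lambda>k. 1 \<le> real k powr \<alpha> * f (real k)) sequentially"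
      by (rule eventually_compose_filterlim[OF _ filterlim_real_sequentially])
    then show ?thesis
      using eventually_gt_at_top[of 0]
      by eventually_elim (simp add: powr_minus field_simps)
  qed
  obtain K where K: "K > 0" "\<And>k. k \<ge> K \<Longrightarrow> real k powr (- 1) \<le> f (real k)"
    using eventually_conj[OF ge[of 1] eventually_gt_at_top[of 0]]
    by (auto simp: eventually_sequentially)
  define h where "h = (\<lambda>k. Min (insert 1 ((\<lambda>j. f (real j)) ` {K..k})))"
  have pos: "0 < f (real j)" if "j \<ge> K" for j
    using K(2)[OF that] K(1) that by (smt (verit) of_nat_0_less_iff powr_gt_zero order_less_le_trans)
  have "h \<in> SS"
  proof (rule SS_I)
    show "antimono h"
      unfolding h_def by (intro antimonoI Min_antimono) auto
    show "0 \<le> h k" for k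
      unfolding h_def using pos by (subst Min_ge_iff) (auto intro: less_imp_le)
    fix \<alpha> :: real assume \<alpha>: "\<alpha> > 0"
    obtain J where J: "\<And>j. j \<ge> J \<Longrightarrow> real j powr (- \<alpha>) \<le> f (real j)"
      using ge[OF \<alpha>] by (auto simp: eventually_sequentially)
    have "((\<lambda>k. real k powr (- \<alpha>)) \<longlongrightarrow> 0) sequentially"
      using \<alpha> by real_asymp
    moreover have "0 < real (Suc J) powr (- 1)" by simp
    \<comment> \<open>The finitely many \<open>f (real j)\<close> with \<open>j < J\<close> stay
      above a fixed positive constant, which \<open>real k powr (- \<alpha>)\<close> eventually
      undercuts.\<close>
    ultimately have "eventually (\<lambda>k. real k powr (- \<alpha>) < real (Suc J) powr (- 1)) sequentially"
      by (rule order_tendstoD)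
    then show "eventually (\<lambda>k. real k powr (- \<alpha>) \<le> h k) sequentially"
      using eventually_ge_at_top[of 1]
    proof eventually_elim
      case (elim k)
      have "real k powr (- \<alpha>) \<le> f (real j)" if j: "K \<le> j" "j \<le> k" for j
      proof (cases "J \<le> j")
        case True
        have "real k powr (- \<alpha>) \<le> real j powr (- \<alpha>)"
          using j K(1) \<alpha> by (intro powr_mono2') auto
        then show ?thesis using J[OF True] by linarith
      next
        case False
        then have "real (Suc J) powr (- 1) \<le> real j powr (- 1)"
          using j K(1) by (intro powr_mono2') auto
        then show ?thesis using elim K(2)[OF j(1)] by linarith
      qed
      moreover have "real k powr (- \<alpha>) \<le> 1"
        using elim \<alpha> by (simp add: powr_minus field_simps ge_one_powr_ge_zero)
      ultimately show ?case
        unfolding h_def by (subst Min_ge_iff) auto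
    qed
  qed (simp add: h_def)
  moreover have "eventually (\<lambda>k. h k \<le> f (real k)) sequentially"
    using eventually_ge_at_top[of K] by eventually_elim (auto simp: h_def intro!: min.coboundedI2 Min_le)
  moreover have "h k \<le> 1" for k by (simp add: h_def)
  ultimately show ?thesis using that by blast
qed

text \<open>The bound \<open>h k \<le> 1\<close> keeps the quotient at least \<open>c\<close>, and
  the lower growth of \<open>h\<close> is its upper growth. This makes a multiple of
  \<open>h\<close> an admissible accuracy in the definition of tractability.\<close>

lemma subpoly_inverse_SS:
  assumes h: "h \<in> SS" "\<And>k. h k \<le> 1" and c: "c > 0"
  shows "subpoly (\<lambda>x. c / h (nat \<lfloor>x\<rfloor>))"
proof -
  have "filterlim (\<lambda>x. x powr \<alpha> * (c / h (nat \<lfloor>x\<rfloor>))) at_top at_top" if "\<alpha> > 0" for \<alpha>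
  proof (rule filterlim_at_top_mono)
    show "filterlim (\<lambda>x::real. x powr \<alpha> * c) at_top at_top"
      using that c by real_asymp
    have "c \<le> c / h k" for k
      using c h(2)[of k] SS_pos[OF h(1), of k] by (simp add: field_simps)
    then show "eventually (\<lambda>x. x powr \<alpha> * c \<le> x powr \<alpha> * (c / h (nat \<lfloor>x\<rfloor>))) at_top"
      by (intro always_eventually allI mult_left_mono) auto
  qed
  moreover have "((\<lambda>x. x powr (- \<alpha>) * (c / h (nat \<lfloor>x\<rfloor>))) \<longlongrightarrow> 0) at_top" if "\<alpha> > 0" for \<alpha>
  proof (rule tendsto_sandwich[OF _ _ tendsto_const])
    have "filterlim (\<lambda>x::real. nat \<lfloor>x\<rfloor>) sequentially at_top"
      by (rule filterlim_compose[OF filterlim_nat_sequentially filterlim_floor_sequentially])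
    from filterlim_compose[OF SS_at_top[OF h(1) that] this]
    have "filterlim (\<lambda>x::real. real (nat \<lfloor>x\<rfloor>) powr \<alpha> * h (nat \<lfloor>x\<rfloor>)) at_top at_top" .
    then show "((\<lambda>x::real. c / (real (nat \<lfloor>x\<rfloor>) powr \<alpha> * h (nat \<lfloor>x\<rfloor>))) \<longlongrightarrow> 0) at_top"
      by (intro tendsto_divide_0[OF tendsto_const] filterlim_at_top_imp_at_infinity)
    show "eventually (\<lambda>x. x powr (- \<alpha>) * (c / h (nat \<lfloor>x\<rfloor>)) \<le>
        c / (real (nat \<lfloor>x\<rfloor>) powr \<alpha> * h (nat \<lfloor>x\<rfloor>))) at_top"
      using eventually_ge_at_top[of 1]
    proof eventually_elim
      case (elim x)
      have "0 < real (nat \<lfloor>x\<rfloor>)" "real (nat \<lfloor>x\<rfloor>) \<le> x"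
        using elim by auto
      then have "x powr (- \<alpha>) \<le> real (nat \<lfloor>x\<rfloor>) powr (- \<alpha>)"
        using that by (intro powr_mono2') auto
      then have "x powr (- \<alpha>) * (c / h (nat \<lfloor>x\<rfloor>)) \<le>
          real (nat \<lfloor>x\<rfloor>) powr (- \<alpha>) * (c / h (nat \<lfloor>x\<rfloor>))"
        using c SS_pos[OF h(1), of "nat \<lfloor>x\<rfloor>"] by (intro mult_right_mono) auto
      then show ?case by (simp add: powr_minus field_simps)
    qed
    show "eventually (\<lambda>x. 0 \<le> x powr (- \<alpha>) * (c / h (nat \<lfloor>x\<rfloor>))) at_top"
      using c less_imp_le[OF SS_pos[OF h(1)]] by (intro always_eventually allI) simp
  qed
  moreover have "c / h k \<ge> 0" for k
    using c SS_pos[OF h(1), of k] by simp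
  ultimately show ?thesis
    by (simp add: subpoly_def)
qed

section \<open>Space lower bounds for tractable functions\<close>

text \<open>Relative error \<open>H / 100\<close> costs at most \<open>H / 50 * B\<close>, and the
  noise little more than another \<open>H / 50 * B\<close>; together they stay below the gap
  \<open>H / 4 * B\<close>.\<close>

lemma separated_values:
  fixes A B H N :: real
  assumes H: "0 < H" "H \<le> 1" and AB: "0 \<le> A" "A \<le> B" "0 < B"
    and gap: "H / 4 * B \<le> B - A" and N: "0 \<le> N" "N \<le> H / 50 * B"
  shows "(1 + H / 100) * (A + N) < (1 - H / 100) * B"
proof -
  have "0 < H * B" "H * A \<le> H * B"
    using assms by (auto intro: mult_left_mono)
  moreover have "H * N \<le> 1 * N"
    using H N by (intro mult_right_mono)
  ultimately show ?thesis
    using gap N by (simp add: algebra_simps add_divide_distrib)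
qed

lemma GG_zero: "g \<in> GG \<Longrightarrow> g 0 = 0"
  and GG_pos: "g \<in> GG \<Longrightarrow> x > 0 \<Longrightarrow> g x > 0"
  by (auto simp: GG_def)

lemma GG_nonneg: "g \<in> GG \<Longrightarrow> g x \<ge> 0"
  using GG_zero[of g] GG_pos[of g x] by (cases x) auto

text \<open>Run the algorithm with accuracy \<open>h / 100\<close>. Once \<open>n * M\<close> is
  large, its space is below \<open>(n * M) powr \<kappa> / 36\<close>, which cancels the constant of
  the space bound, and \<open>(n * M) powr (- \<kappa>)\<close> is below \<open>h / 50\<close>, as
  separation demands. The maximum covers both signs of the gap.\<close>

lemma tractable_lower_bound:
  assumes g: "g \<in> GG" and tr: "one_pass_tractable g"
    and h: "h \<in> SS" "\<And>k. h k \<le> 1" and \<kappa>: "\<kappa> > 0"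
  obtains Z :: nat where "\<And>n M t x r.
    n \<ge> 1 \<Longrightarrow> M \<ge> 1 \<Longrightarrow> t \<ge> 1 \<Longrightarrow> Z \<le> n * M \<Longrightarrow> x * t + r \<le> M \<Longrightarrow> 0 < x * t + r \<Longrightarrow>
    real n * g x \<le> real (n * M) powr (- \<kappa>) * max (g r) (g (x * t + r)) \<Longrightarrow>
    h (n * M) / 4 * max (g r) (g (x * t + r)) \<le> \<bar>g (x * t + r) - g r\<bar> \<Longrightarrow>
    real n < (real t)\<^sup>2 * real (n * M) powr \<kappa>"
proof -
  note gpos = GG_pos[OF g] and gnn = GG_nonneg[OF g]
  define H where "H = (\<lambda>x::real. 100 / h (nat \<lfloor>x\<rfloor>))"
  have "subpoly H"
    unfolding H_def by (rule subpoly_inverse_SS[OF h]) simp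
  then obtain hs where hs: "subpoly hs" and alg: "\<And>n M m. n \<ge> 1 \<Longrightarrow> M \<ge> 1 \<Longrightarrow>
      \<exists>A s. real s \<le> hs (real (n * M)) \<and> uses_bits A s \<and> solves_sum g (1 / H (real (n * M))) n M m A"
    using tr[unfolded one_pass_tractable_def, rule_format, of H "\<lambda>n M. 1 / H (real (n * M))"] by auto
  have "((\<lambda>x. x powr (- \<kappa>) * hs x) \<longlongrightarrow> 0) at_top"
    using hs \<kappa> by (simp add: subpoly_def)
  then have "eventually (\<lambda>x. x powr (- \<kappa>) * hs x < 1 / 36) at_top"
    by (rule order_tendstoD) simp
  then have "eventually (\<lambda>k. real k powr (- \<kappa>) * hs (real k) < 1 / 36) sequentially"
    by (rule eventually_compose_filterlim[OF _ filterlim_real_sequentially])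
  moreover have "eventually (\<lambda>k. real k powr (- \<kappa>) \<le> 1 / 50 * h k) sequentially"
    by (rule SS_ge_powr[OF h(1) \<kappa>]) simp
  ultimately have "eventually (\<lambda>k. real k powr (- \<kappa>) * hs (real k) < 1 / 36 \<and>
      real k powr (- \<kappa>) \<le> 1 / 50 * h k) sequentially"
    by (rule eventually_conj)
  then obtain Z where Z: "\<And>k. k \<ge> Z \<Longrightarrow> real k powr (- \<kappa>) * hs (real k) < 1 / 36"
    "\<And>k. k \<ge> Z \<Longrightarrow> real k powr (- \<kappa>) \<le> 1 / 50 * h k"
    by (auto simp: eventually_sequentially)
  show thesis
  proof (rule that[of Z])
    fix n M t x r :: nat
    assume n: "n \<ge> 1" and M: "M \<ge> 1" and t: "t \<ge> 1" and z: "Z \<le> n * M"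
      and le: "x * t + r \<le> M" and pos: "0 < x * t + r"
      and noise: "real n * g x \<le> real (n * M) powr (- \<kappa>) * max (g r) (g (x * t + r))"
      and gap: "h (n * M) / 4 * max (g r) (g (x * t + r)) \<le> \<bar>g (x * t + r) - g r\<bar>"
    define z where "z = real (n * M)"
    have z0: "z > 0" using n M by (simp add: z_def)
    define \<eta> where "\<eta> = h (n * M)"
    have \<eta>: "0 < \<eta>" "\<eta> \<le> 1" using SS_pos[OF h(1)] h(2) by (auto simp: \<eta>_def)
    have eps: "1 / H (real (n * M)) = \<eta> / 100"
      by (simp add: H_def \<eta>_def del: of_nat_mult)
    define m where "m = max (g r) (g (x * t + r))"
    have m: "m > 0" using gpos[OF pos] by (auto simp: m_def)
    obtain A s where s: "real s \<le> hs z" and A: "uses_bits A s" "solves_sum g (\<eta> / 100) n M (2 * n) A"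
      using alg[OF n M, of "2 * n"] unfolding eps z_def by auto
    have "real n * g x \<le> z powr (- \<kappa>) * m"
      using noise by (simp add: m_def z_def)
    also have "\<dots> \<le> 1 / 50 * \<eta> * m"
      using Z(2)[OF z] m unfolding \<eta>_def z_def by (intro mult_right_mono) auto
    finally have N: "real n * g x \<le> \<eta> / 50 * m" by simp
    have sep: "(1 + \<eta> / 100) * (g r + real n * g x) < (1 - \<eta> / 100) * g (x * t + r) \<or>
      (1 + \<eta> / 100) * (g (x * t + r) + real n * g x) < (1 - \<eta> / 100) * g r"
    proof (cases "g r \<le> g (x * t + r)")
      case True
      then show ?thesis
        using \<eta> gnn gap N m by (intro disjI1 separated_values) (auto simp: m_def \<eta>_def)
    next
      case False
      then show ?thesis
        using \<eta> gnn gap N m by (intro disjI2 separated_values) (auto simp: m_def \<eta>_def)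
    qed
    have "real n \<le> 36 * (real t)\<^sup>2 * real s"
      using sep \<eta> t le by (intro sum_space_lower_bound[OF GG_zero[OF g] gnn A]) auto
    also have "\<dots> \<le> 36 * (real t)\<^sup>2 * hs z"
      using s by (intro mult_left_mono) auto
    also have "hs z < z powr \<kappa> / 36"
      using Z(1)[OF z, folded z_def] z0 by (simp add: powr_minus field_simps)
    finally show "real n < (real t)\<^sup>2 * real (n * M) powr \<kappa>"
      using t by (simp add: z_def)
  qed
qed

text \<open>With \<open>t = 1\<close> the lower bound is that of the INDEX problem: a receiver adding \<open>x\<close> to one
  coordinate learns whether the sender had put \<open>y\<close> there.\<close>

lemma tractable_index:
  assumes g: "g \<in> GG" and tr: "one_pass_tractable g"
    and h: "h \<in> SS" "\<And>k. h k \<le> 1" and \<beta>: "\<beta> > 0"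
  obtains Z :: nat where "\<And>z x y. Z \<le> z \<Longrightarrow> 0 < x \<Longrightarrow> x \<le> z \<Longrightarrow> y \<le> z \<Longrightarrow>
    g y * real z powr \<beta> \<le> g x \<Longrightarrow> \<bar>g (x + y) - g x\<bar> \<le> h z * min (g x) (g (x + y))"
proof -
  note gpos = GG_pos[OF g]
  \<comment> \<open>Below, \<open>n * M\<close> is at most
    \<open>4 * z powr (1 + \<beta> / 2)\<close>; this exponent reduces its power to at most
    \<open>2 * z powr (\<beta> / 4)\<close>.\<close>
  define \<kappa> where "\<kappa> = \<beta> / (4 + 2 * \<beta>)"
  have \<kappa>: "\<kappa> > 0" "\<kappa> \<le> 1 / 2" "(1 + \<beta> / 2) * \<kappa> = \<beta> / 4"
    using \<beta> by (auto simp: \<kappa>_def field_simps)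
  obtain Z where Z: "\<And>n M t x r.
    n \<ge> 1 \<Longrightarrow> M \<ge> 1 \<Longrightarrow> t \<ge> 1 \<Longrightarrow> Z \<le> n * M \<Longrightarrow> x * t + r \<le> M \<Longrightarrow> 0 < x * t + r \<Longrightarrow>
    real n * g x \<le> real (n * M) powr (- \<kappa>) * max (g r) (g (x * t + r)) \<Longrightarrow>
    h (n * M) / 4 * max (g r) (g (x * t + r)) \<le> \<bar>g (x * t + r) - g r\<bar> \<Longrightarrow>
    real n < (real t)\<^sup>2 * real (n * M) powr \<kappa>"
    using tractable_lower_bound[OF g tr h \<kappa>(1)] by blast
  have "eventually (\<lambda>z. 4 \<le> real z powr (\<beta> / 4)) sequentially"
    using nat_powr_at_top[of "\<beta> / 4"] \<beta> by (simp add: filterlim_at_top)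
  then obtain Z' where Z': "\<And>z. z \<ge> Z' \<Longrightarrow> 4 \<le> real z powr (\<beta> / 4)"
    by (auto simp: eventually_sequentially)
  show thesis
  proof (rule that[of "max Z Z'"], rule ccontr)
    fix z x y :: nat
    assume z: "max Z Z' \<le> z" and x: "0 < x" "x \<le> z" and y: "y \<le> z"
      and drop: "g y * real z powr \<beta> \<le> g x"
      and "\<not> \<bar>g (x + y) - g x\<bar> \<le> h z * min (g x) (g (x + y))"
    then have gap: "h z * min (g x) (g (x + y)) \<le> \<bar>g (x + y) - g x\<bar>" by simp
    have z0: "z > 0" using x by simp
    define u where "u = real z powr (\<beta> / 4)"
    have u: "4 \<le> u" using Z' z by (simp add: u_def)
    have u2: "u\<^sup>2 = real z powr (\<beta> / 2)" and u4: "u ^ 4 = real z powr \<beta>"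
      using z0 by (simp_all add: u_def powr_power)
    \<comment> \<open>With \<open>n\<close> about \<open>u\<^sup>2\<close>, the count exceeds the
      bound \<open>2 * u\<close> on the space term, yet the noise \<open>n * g y\<close> is at most
      \<open>2 / u\<^sup>2\<close> times \<open>g x\<close>. The choice \<open>M = 2 * z\<close>
      leaves room for \<open>x + y\<close>.\<close>
    define n where "n = nat \<lceil>u\<^sup>2\<rceil>"
    have "1 \<le> u\<^sup>2" using u by simp
    then have n: "u\<^sup>2 \<le> real n" "real n \<le> 2 * u\<^sup>2" "n \<ge> 1"
      unfolding n_def by linarith+
    have zle: "z \<le> n * (2 * z)" using n(3) by (cases n) auto
    have Zle: "Z \<le> n * (2 * z)" using z order_trans[OF _ zle] by simp
    have "real (n * (2 * z)) powr \<kappa> \<le> (4 * (u\<^sup>2 * real z)) powr \<kappa>"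
      using n(2) \<kappa>(1) mult_right_mono[OF n(2), of "real z"] by (intro powr_mono2) (auto simp: mult_ac)
    also have "\<dots> = 4 powr \<kappa> * (real z powr (1 + \<beta> / 2)) powr \<kappa>"
      using z0 by (simp add: powr_mult u2 powr_add mult.commute)
    also have "\<dots> = 4 powr \<kappa> * u"
      by (simp add: powr_powr \<kappa>(3) u_def)
    also have "\<dots> \<le> 4 powr (1 / 2) * u"
      using \<kappa>(2) u by (intro mult_right_mono powr_mono) auto
    also have "\<dots> = 2 * u" by (simp add: powr_half_sqrt)
    finally have nM: "real (n * (2 * z)) powr \<kappa> \<le> 2 * u" .
    have nM0: "real (n * (2 * z)) powr \<kappa> > 0" using n(3) z0 by simp
    have "real n < (real 1)\<^sup>2 * real (n * (2 * z)) powr \<kappa>"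
    \<comment> \<open>The roles are exchanged: \<open>y\<close> is Alice's unit, so
      \<open>g y\<close> is the noise, and \<open>x\<close> is Bob's update.\<close>
    proof (rule Z[where x = y and r = x])
      have gx: "g x > 0" using gpos x by simp
      have "real n * g y \<le> 2 * u\<^sup>2 * g y"
        using n(2) GG_nonneg[OF g] by (intro mult_right_mono) auto
      also have "\<dots> \<le> 2 * u\<^sup>2 * (g x / u ^ 4)"
        using drop u unfolding u4 [symmetric] by (intro mult_left_mono) (auto simp: field_simps)
      also have "\<dots> = g x * (2 / u\<^sup>2)"
        using u by (simp add: field_simps power2_eq_square power4_eq_xxxx)
      also have "\<dots> \<le> g x * (1 / (2 * u))"
        using gx u by (intro mult_left_mono) (auto simp: field_simps power2_eq_square)
      also have "\<dots> \<le> g x * real (n * (2 * z)) powr (- \<kappa>)"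
        using gx frac_le[OF _ _ nM0 nM, of 1 1]
        by (intro mult_left_mono) (auto simp: powr_minus_divide simp del: of_nat_mult)
      also have "\<dots> \<le> max (g x) (g (y * 1 + x)) * real (n * (2 * z)) powr (- \<kappa>)"
        by (intro mult_right_mono) auto
      finally show "real n * g y \<le> real (n * (2 * z)) powr (- \<kappa>) * max (g x) (g (y * 1 + x))"
        by (simp add: mult.commute)
      have h01: "0 < h (n * (2 * z))" "h (n * (2 * z)) \<le> h z" "h z \<le> 1"
        using SS_pos[OF h(1)] SS_antimono[OF h(1) zle] h(2) by auto
      define a b where "a = g x" and "b = g (x + y)"
      have b: "b > 0" "a > 0" using gpos x by (auto simp: a_def b_def)
      have "h (n * (2 * z)) / 4 * max a b \<le> h z * max a b"
        using h01 b by (intro mult_right_mono) auto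
      \<comment> \<open>Since \<open>h z \<le> 1\<close>, this gives
        \<open>h z * max a b \<le> 2 * \<bar>b - a\<bar>\<close>. Passing from the minimum to the
        maximum thus costs a factor 2, within the allowed 4.\<close>
      moreover have "h z * max a b = h z * min a b + h z * \<bar>b - a\<bar>"
        by (simp add: max_def min_def algebra_simps abs_if)
      moreover have "h z * \<bar>b - a\<bar> \<le> 1 * \<bar>b - a\<bar>"
        using h01 by (intro mult_right_mono) auto
      moreover have "h (n * (2 * z)) / 4 * max a b \<le> h z / 4 * max a b"
        using h01 b by (intro mult_right_mono) auto
      ultimately have "h (n * (2 * z)) / 4 * max a b \<le> \<bar>b - a\<bar>"
        using gap by (simp add: a_def b_def)
      then show "h (n * (2 * z)) / 4 * max (g x) (g (y * 1 + x)) \<le> \<bar>g (y * 1 + x) - g x\<bar>"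
        by (simp add: a_def b_def add.commute)
    qed (use x y n Zle in auto)
    then have "u\<^sup>2 < 2 * u" using n(1) nM by simp
    then show False using u by (simp add: power2_eq_square)
  qed
qed

section \<open>Necessity of the three conditions\<close>

text \<open>A failure of slow-dropping is the first half of near periodicity, and the index bound at
  \<open>z = y\<close> is the second half, so normality is contradicted.\<close>

lemma slow_dropping_if_tractable:
  assumes g: "g \<in> GG" and tr: "one_pass_tractable g" and normal: "normal SS g"
  shows "slow_dropping g"
proof (rule ccontr)
  assume "\<not> slow_dropping g"
  then obtain \<alpha>0 where "\<alpha>0 > 0" and
    neg: "\<not> (\<exists>N>0. \<forall>x y::nat. x < y \<longrightarrow> N \<le> y \<longrightarrow> g x / real y powr \<alpha>0 \<le> g y)"
    unfolding slow_dropping_def by blast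
  have "\<exists>x y::nat. x < y \<and> N \<le> y \<and> g y \<le> g x / real y powr \<alpha>0" if "N > 0" for N
    using neg that by (meson linear)
  with \<open>\<alpha>0 > 0\<close> have "\<exists>\<alpha>>0. \<forall>N>0. \<exists>x y::nat. x < y \<and> N \<le> y \<and> g y \<le> g x / real y powr \<alpha>"
    by blast
  moreover have "\<exists>N1>0. \<forall>y::nat. \<forall>x::nat.
        (\<exists>x'<y. g y \<le> g x' / real y powr \<alpha>) \<longrightarrow> N1 \<le> y \<longrightarrow> x < y \<longrightarrow>
        g y * real y powr \<alpha> \<le> g x \<longrightarrow>
        \<bar>g (x + y) - g x\<bar> \<le> min (g x) (g (x + y)) * h y"
    if \<alpha>: "\<alpha> > 0" and h: "h \<in> SS" for \<alpha> h
  proof -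
    obtain Z where Z: "\<And>z x y. Z \<le> z \<Longrightarrow> 0 < x \<Longrightarrow> x \<le> z \<Longrightarrow> y \<le> z \<Longrightarrow>
        g y * real z powr \<alpha> \<le> g x \<Longrightarrow> \<bar>g (x + y) - g x\<bar> \<le> min 1 (h z) * min (g x) (g (x + y))"
      using tractable_index[OF g tr SS_min_one[OF h] _ \<alpha>] by auto
    have "\<bar>g (x + y) - g x\<bar> \<le> min (g x) (g (x + y)) * h y"
      if y: "Suc Z \<le> y" and x: "x < y" and drop: "g y * real y powr \<alpha> \<le> g x" for x y
    proof -
      have "0 < g y * real y powr \<alpha>"
        using x GG_pos[OF g, of y] by simp
      \<comment> \<open>At \<open>x = 0\<close> the drop would require a positive quantity to be at
        most \<open>g 0 = 0\<close>.\<close>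
      then have "x > 0"
        using drop GG_zero[OF g] by (cases x) auto
      then have "\<bar>g (x + y) - g x\<bar> \<le> min 1 (h y) * min (g x) (g (x + y))"
        using x y drop by (intro Z) auto
      also have "\<dots> \<le> h y * min (g x) (g (x + y))"
        using GG_nonneg[OF g] by (intro mult_right_mono) auto
      finally show ?thesis by (simp add: mult.commute)
    qed
    then show ?thesis by (intro exI[of _ "Suc Z"]) blast
  qed
  ultimately show False
    using normal unfolding normal_def nearly_periodic_def by blast
qed

text \<open>The index bound at \<open>z = x\<close>, for a monotone minorant of the accuracy: if
  \<open>g y\<close> were too small, \<open>x + y\<close> would be stable.\<close>

lemma predictable_if_tractable:
  assumes g: "g \<in> GG" and tr: "one_pass_tractable g"
  shows "predictable g"
  unfolding predictable_def
proof (intro allI impI)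
  fix \<gamma> :: real and eps :: "real \<Rightarrow> real"
  assume \<gamma>: "0 < \<gamma> \<and> \<gamma> < 1" and "subpoly eps"
  then obtain h where h: "h \<in> SS" "\<And>k. h k \<le> 1" and ev: "eventually (\<lambda>k. h k \<le> eps (real k)) sequentially"
    using SS_below_subpoly by blast
  obtain K where K: "\<And>k. k \<ge> K \<Longrightarrow> h k \<le> eps (real k)"
    using ev by (auto simp: eventually_sequentially)
  obtain Z where Z: "\<And>z x y. Z \<le> z \<Longrightarrow> 0 < x \<Longrightarrow> x \<le> z \<Longrightarrow> y \<le> z \<Longrightarrow>
      g y * real z powr \<gamma> \<le> g x \<Longrightarrow> \<bar>g (x + y) - g x\<bar> \<le> h z * min (g x) (g (x + y))"
    using tractable_index[OF g tr h] \<gamma> by blast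
  have "real x powr (- \<gamma>) * g x \<le> g y"
    if x: "Suc (max K Z) \<le> x" and y: "real y < real x powr (1 - \<gamma>)"
      and unstable: "x + y \<notin> delta_set g (eps (real x)) x" for x y :: nat
  proof (rule ccontr)
    assume "\<not> ?thesis"
    then have drop: "g y < g x / real x powr \<gamma>" by (simp add: powr_minus field_simps)
    have "real x powr (1 - \<gamma>) \<le> real x powr 1"
      using x \<gamma> by (intro powr_mono) auto
    then have "y \<le> x" using x y by simp
    then have "\<bar>g (x + y) - g x\<bar> \<le> h x * min (g x) (g (x + y))"
      using x drop by (intro Z) (auto simp: field_simps)
    also have "\<dots> \<le> h x * g x"
      using SS_pos[OF h(1), of x] by (intro mult_left_mono) auto
    also have "\<dots> \<le> eps (real x) * g x"
      using K[of x] x GG_nonneg[OF g] by (intro mult_right_mono) auto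
    finally show False
      using unstable by (simp add: delta_set_def)
  qed
  then show "\<exists>N. \<forall>x y::nat. N \<le> x \<longrightarrow> 1 \<le> y \<longrightarrow> real y < real x powr (1 - \<gamma>) \<longrightarrow>
        x + y \<notin> delta_set g (eps (real x)) x \<longrightarrow> g y \<ge> real x powr (-\<gamma>) * g x"
    by blast
qed

text \<open>Slow-dropping speaks of large \<open>x\<close> only; the finitely many smaller pairs are
  absorbed into \<open>C\<close>, the sum of all their ratios plus 1.\<close>

lemma slow_dropping_bound:
  assumes g: "g \<in> GG" and sd: "slow_dropping g" and \<delta>: "\<delta> > 0"
  obtains C where "C \<ge> 1" "\<And>r x. r < x \<Longrightarrow> g r \<le> C * real x powr \<delta> * g x"
proof -
  obtain N where N: "\<And>x y. x < y \<Longrightarrow> N \<le> y \<Longrightarrow> g x / real y powr \<delta> \<le> g y"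
    using sd \<delta> unfolding slow_dropping_def by blast
  define C where "C = 1 + (\<Sum>(r, x)\<in>{..<N} \<times> {..<N}. g r / g x)"
  have nn: "g r / g x \<ge> 0" for r x using GG_nonneg[OF g] by simp
  have C1: "C \<ge> 1" using nn by (simp add: C_def sum_nonneg split_def)
  have "g r \<le> C * real x powr \<delta> * g x" if x: "r < x" for r x
  proof (cases "N \<le> x")
    case True
    then have "g r \<le> 1 * (real x powr \<delta> * g x)"
      using N[OF x True] x by (simp add: field_simps)
    also have "\<dots> \<le> C * (real x powr \<delta> * g x)"
      using C1 GG_nonneg[OF g] by (intro mult_right_mono) auto
    finally show ?thesis by (simp add: mult_ac)
  next
    case False
    have "(case (r, x) of (r, x) \<Rightarrow> g r / g x) \<le> (\<Sum>(r, x)\<in>{..<N} \<times> {..<N}. g r / g x)"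
      using False x nn by (intro member_le_sum) auto
    then have "g r / g x \<le> C" by (simp add: C_def)
    then have "g r \<le> C * g x * 1"
      using GG_pos[OF g, of x] x by (simp add: field_simps)
    also have "\<dots> \<le> C * g x * real x powr \<delta>"
      using C1 GG_nonneg[OF g] x \<delta> by (intro mult_left_mono) (auto intro: ge_one_powr_ge_zero)
    finally show ?thesis by (simp add: mult_ac)
  qed
  with C1 that show thesis by blast
qed

text \<open>A jump makes \<open>g x\<close> tiny against \<open>g y\<close>. Slow-dropping transfers
  this to the remainder \<open>r\<close>, so the gap is a constant fraction of \<open>g y\<close>
  and constant accuracy suffices.\<close>

lemma slow_jumping_if_tractable:
  assumes g: "g \<in> GG" and tr: "one_pass_tractable g" and sd: "slow_dropping g"
  shows "slow_jumping g"
  unfolding slow_jumping_def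
proof (intro allI impI)
  fix \<alpha> :: real assume \<alpha>: "\<alpha> > 0"
  \<comment> \<open>Here \<open>n * y\<close> will be at most
    \<open>2 * y powr (3 + \<alpha> / 2)\<close>, as \<open>n\<close> is of order
    \<open>t\<^sup>2 * u\<^sup>2\<close> and \<open>t \<le> y\<close>; its power is then at most
    \<open>2 * u\<close>.\<close>
  define \<kappa> where "\<kappa> = \<alpha> / (12 + 2 * \<alpha>)"
  have \<kappa>: "\<kappa> > 0" "\<kappa> \<le> 1" "(3 + \<alpha> / 2) * \<kappa> = \<alpha> / 4"
    using \<alpha> by (auto simp: \<kappa>_def field_simps)
  have one: "(\<lambda>_. 1) \<in> SS"
  proof (rule SS_I)
    show "eventually (\<lambda>k. real k powr (- a) \<le> 1) sequentially" if "a > 0" for a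
      using eventually_ge_at_top[of 1]
      by eventually_elim (use that in \<open>auto simp: powr_minus field_simps ge_one_powr_ge_zero\<close>)
  qed (auto intro: antimonoI)
  obtain Z where Z: "\<And>n M t x r.
    n \<ge> 1 \<Longrightarrow> M \<ge> 1 \<Longrightarrow> t \<ge> 1 \<Longrightarrow> Z \<le> n * M \<Longrightarrow> x * t + r \<le> M \<Longrightarrow> 0 < x * t + r \<Longrightarrow>
    real n * g x \<le> real (n * M) powr (- \<kappa>) * max (g r) (g (x * t + r)) \<Longrightarrow>
    1 / 4 * max (g r) (g (x * t + r)) \<le> \<bar>g (x * t + r) - g r\<bar> \<Longrightarrow>
    real n < (real t)\<^sup>2 * real (n * M) powr \<kappa>"
    using tractable_lower_bound[OF g tr one _ \<kappa>(1)] by auto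
  obtain C where C: "C \<ge> 1" "\<And>r x. r < x \<Longrightarrow> g r \<le> C * real x powr (\<alpha> / 2) * g x"
    using slow_dropping_bound[OF g sd, of "\<alpha> / 2"] \<alpha> by auto
  \<comment> \<open>One threshold for \<open>u\<close>: the factor \<open>C\<close> pays for the
    bound on \<open>g r\<close>, the factor \<open>4 * 2 powr \<alpha>\<close> for the
    noise.\<close>
  define B where "B = 4 * C * 2 powr \<alpha>"
  have "1 * 1 \<le> C * 2 powr \<alpha>"
    using C(1) \<alpha> by (intro mult_mono ge_one_powr_ge_zero) auto
  then have B4: "B \<ge> 4" by (simp add: B_def)
  have Ba: "4 * 2 powr \<alpha> \<le> B"
    using C(1) by (simp add: B_def)
  have "eventually (\<lambda>y. B \<le> real y powr (\<alpha> / 4)) sequentially"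
    using nat_powr_at_top[of "\<alpha> / 4"] \<alpha> by (simp add: filterlim_at_top)
  then obtain Z' where Z': "\<And>y. y \<ge> Z' \<Longrightarrow> B \<le> real y powr (\<alpha> / 4)"
    by (auto simp: eventually_sequentially)
  have "g y \<le> real (y div x) powr (2 + \<alpha>) * real x powr \<alpha> * g x"
    if x: "0 < x" "x < y" and y: "Suc (max Z Z') \<le> y" for x y
  proof (rule ccontr)
    assume jump: "\<not> ?thesis"
    define t r where "t = y div x" and "r = y mod x"
    have ytr: "x * t + r = y" by (simp add: t_def r_def)
    have r: "r < x" using x by (simp add: r_def)
    have t: "t \<ge> 1" using x by (simp add: t_def div_greater_zero_iff Suc_le_eq)
    define u where "u = real y powr (\<alpha> / 4)"
    have uB: "B \<le> u" using Z' y by (simp add: u_def)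
    then have u: "4 \<le> u" using B4 by simp
    have u2: "u\<^sup>2 = real y powr (\<alpha> / 2)" and u4: "u ^ 4 = real y powr \<alpha>"
      using x by (simp_all add: u_def powr_power)
    have gy: "g y > 0" and gx: "g x > 0" using GG_pos[OF g] x by auto
    define T where "T = (real t)\<^sup>2"
    have T: "T \<ge> 1" using t by (simp add: T_def)
    \<comment> \<open>The remainder is below \<open>x * t\<close>, so \<open>y\<close> is at most
      twice \<open>x * t\<close>; the power of \<open>t * x\<close> in the failed inequality can be
      replaced by one of \<open>y\<close>.\<close>
    have "x \<le> x * t" using t by (cases t) auto
    then have "y \<le> 2 * (x * t)" using r ytr by linarith
    then have "real y \<le> real (2 * (x * t))"
      by (simp only: of_nat_le_iff)
    then have "real y \<le> 2 * (real t * real x)"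
      by (simp add: mult.commute)
    then have "real y powr \<alpha> \<le> (2 * (real t * real x)) powr \<alpha>"
      using \<alpha> by (intro powr_mono2) auto
    then have "u ^ 4 \<le> 2 powr \<alpha> * (real t powr \<alpha> * real x powr \<alpha>)"
      by (simp add: u4 powr_mult)
    then have "T * (u ^ 4 * g x) \<le> T * (2 powr \<alpha> * (real t powr \<alpha> * real x powr \<alpha>) * g x)"
      using T gx by (intro mult_left_mono mult_right_mono) auto
    also have "\<dots> = 2 powr \<alpha> * (real t powr (2 + \<alpha>) * real x powr \<alpha> * g x)"
      using t by (simp add: T_def powr_add)
    also have "\<dots> \<le> 2 powr \<alpha> * g y"
      using jump by (intro mult_left_mono) (auto simp: t_def)
    finally have gap: "T * u ^ 4 * g x \<le> 2 powr \<alpha> * g y" by simp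
    then have gx_le: "g x \<le> 2 powr \<alpha> * g y / (T * u ^ 4)"
      using T u by (simp add: field_simps)
    have gr: "g r \<le> g y / 2"
    proof -
      have "g r \<le> C * u\<^sup>2 * g x"
      proof -
        have "real x powr (\<alpha> / 2) \<le> u\<^sup>2"
          unfolding u2 using x \<alpha> by (intro powr_mono2) auto
        then have "C * real x powr (\<alpha> / 2) * g x \<le> C * u\<^sup>2 * g x"
          using C(1) gx by (intro mult_left_mono mult_right_mono) auto
        then show ?thesis using C(2)[OF r] by linarith
      qed
      also have "\<dots> \<le> C * u\<^sup>2 * (T * g x)"
        using C(1) T gx by (intro mult_left_mono) auto
      finally have "u\<^sup>2 * g r \<le> u\<^sup>2 * (C * u\<^sup>2 * (T * g x))"
        by (intro mult_left_mono) auto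
      also have "\<dots> = C * (T * u ^ 4 * g x)"
        by (simp add: power2_eq_square power4_eq_xxxx)
      also have "\<dots> \<le> C * (2 powr \<alpha> * g y)"
        using gap C(1) by (intro mult_left_mono) auto
      also have "\<dots> = B / 4 * g y" by (simp add: B_def)
      also have "\<dots> \<le> u\<^sup>2 / 4 * g y"
      proof -
        have "u * 1 \<le> u * u" using u by (intro mult_left_mono) auto
        then have "B \<le> u\<^sup>2" using uB by (simp add: power2_eq_square)
        then show ?thesis using gy by (intro mult_right_mono) auto
      qed
      also have "\<dots> = u\<^sup>2 * (g y / 4)" by simp
      finally have "g r \<le> g y / 4"
        using u by (subst (asm) mult_le_cancel_left_pos) auto
      then show ?thesis using gy by simp
    qed
    \<comment> \<open>This exceeds \<open>2 * T * u\<close>, the bound on the space term, while the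
      noise \<open>n * g x\<close> is only of order \<open>g y / u\<^sup>2\<close>.\<close>
    define n where "n = nat \<lceil>T * u\<^sup>2\<rceil>"
    have "1 * 1 \<le> T * u\<^sup>2" using T u by (intro mult_mono) auto
    then have n: "T * u\<^sup>2 \<le> real n" "real n \<le> 2 * (T * u\<^sup>2)" "n \<ge> 1"
      unfolding n_def by linarith+
    have yle: "y \<le> n * y" using n(3) by (cases n) auto
    have Zle: "Z \<le> n * y" using y order_trans[OF _ yle] by simp
    have "t \<le> y" by (simp add: t_def)
    then have "T \<le> (real y)\<^sup>2" by (simp add: T_def power_mono)
    then have "2 * (T * u\<^sup>2) * real y \<le> 2 * ((real y)\<^sup>2 * u\<^sup>2) * real y"
      by (intro mult_left_mono mult_right_mono) auto
    also have "\<dots> = 2 * (real y powr 3 * real y powr (\<alpha> / 2))"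
      using x unfolding u2 by (simp add: power2_eq_square power3_eq_cube)
    also have "\<dots> = 2 * real y powr (3 + \<alpha> / 2)"
      by (simp only: powr_add)
    finally have "real n * real y \<le> 2 * real y powr (3 + \<alpha> / 2)"
      using mult_right_mono[OF n(2), of "real y"] by simp
    then have "real (n * y) powr \<kappa> \<le> (2 * real y powr (3 + \<alpha> / 2)) powr \<kappa>"
      using \<kappa>(1) by (intro powr_mono2) auto
    also have "\<dots> = 2 powr \<kappa> * u"
      using x by (simp add: powr_mult powr_powr \<kappa>(3) u_def)
    also have "\<dots> \<le> 2 powr 1 * u"
      using \<kappa>(2) u by (intro mult_right_mono powr_mono) auto
    finally have nM: "real (n * y) powr \<kappa> \<le> 2 * u" by simp
    have nM0: "real (n * y) powr \<kappa> > 0" using n(3) x by simp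
    have "real n < (real t)\<^sup>2 * real (n * y) powr \<kappa>"
    proof (rule Z[where x = x and r = r])
      have "real n * g x \<le> 2 * (T * u\<^sup>2) * (2 powr \<alpha> * g y / (T * u ^ 4))"
        using n gx gx_le by (intro mult_mono) auto
      also have "\<dots> = g y * (2 * 2 powr \<alpha> / u\<^sup>2)"
        using u T by (simp add: field_simps power2_eq_square power4_eq_xxxx)
      also have "\<dots> \<le> g y * (1 / (2 * u))"
      proof (intro mult_left_mono)
        have "4 * 2 powr \<alpha> * u \<le> u * u"
          using Ba uB u by (intro mult_right_mono) auto
        then show "2 * 2 powr \<alpha> / u\<^sup>2 \<le> 1 / (2 * u)"
          using u by (simp add: field_simps power2_eq_square)
      qed (use gy in simp)
      also have "\<dots> \<le> g y * real (n * y) powr (- \<kappa>)"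
        using gy frac_le[OF _ _ nM0 nM, of 1 1]
        by (intro mult_left_mono) (auto simp: powr_minus_divide simp del: of_nat_mult)
      also have "\<dots> \<le> max (g r) (g y) * real (n * y) powr (- \<kappa>)"
        by (intro mult_right_mono) auto
      finally show "real n * g x \<le> real (n * y) powr (- \<kappa>) * max (g r) (g (x * t + r))"
        unfolding ytr by (simp add: mult.commute)
      show "1 / 4 * max (g r) (g (x * t + r)) \<le> \<bar>g (x * t + r) - g r\<bar>"
        unfolding ytr using gr gy by simp
    qed (use x n t Zle ytr in auto)
    also have "\<dots> \<le> T * (2 * u)"
      using nM by (auto simp: T_def intro!: mult_left_mono)
    finally have "T * u\<^sup>2 < T * (2 * u)" using n(1) by linarith
    then have "u\<^sup>2 < 2 * u" using T by simp
    then show False using u by (simp add: power2_eq_square)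
  qed
  then show "\<exists>N>0. \<forall>x y::nat. 0 < x \<longrightarrow> x < y \<longrightarrow> N \<le> y \<longrightarrow>
      g y \<le> real (y div x) powr (2 + \<alpha>) * real x powr \<alpha> * g x"
    by (intro exI[of _ "Suc (max Z Z')"]) auto
qed

theorem theorem22:
  fixes g :: "nat \<Rightarrow> real"
  assumes "g \<in> GG" and "one_pass_tractable g" and "normal SS g"
  shows "slow_jumping g \<and> slow_dropping g \<and> predictable g"
  using assms slow_dropping_if_tractable slow_jumping_if_tractable predictable_if_tractable
  by blast

end
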